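(* Let $\mu$ be a continuous computable measure on $\mathbb{B}^\omega$. Then $$\{\mu_U\}_U=\mathcal{A},$$ where $U$ ranges over all universal monotone machines that are compatible with $\mu$, and $\mathcal{A}$ is the class of a priori semimeasures, i.e. the class of functions $\lambda_V$ for all universal monotone machines $V$, with $\lambda$ the uniform measure.
   Context: $\mathbb{B}=\{0,1\}$; $\mathbb{B}^*$ is the set of finite bit strings and $\mathbb{B}^\omega$ the set of infinite bit strings. $\sigma\preccurlyeq\tau$ means $\sigma$ is an initial segment of $\tau$; $\sigma\sim\tau$ means $\sigma\preccurlyeq\tau$ or $\tau\preccurlyeq\sigma$. For $\sigma\in\mathbb{B}^*$, $\llbracket\sigma\rrbracket=\{\sigma X: X\in\mathbb{B}^\omega\}$; for $A\subseteq\mathbb{B}^*$, $\llbracket A\rrbracket=\bigcup_{\sigma\in A}\llbracket\sigma\rrbracket$. A computable measure is a Borel probability measure $\mu$ on $\mathbb{B}^\omega$ such that the reals $\mu(\llbracket\sigma\rrbracket)$ are uniformly computable in $\sigma$: there is a computable $g:\mathbb{B}^*\times\mathbb{N}\to\mathbb{Q}$ with $|g(\sigma,k)-\mu(\llbracket\sigma\rrbracket)|<2^{-k}$ for all $\sigma,k$. It is continuous if $\mu(\{X\})=0$ for every $X\in\mathbb{B}^\omega$. The uniform measure $\lambda$ has $\lambda(\llbracket\sigma\rrbracket)=2^{-|\sigma|}$. A monotone machine is a c.e. set $M\subseteq\mathbb{B}^*\times\mathbb{B}^*$ such that if $(\rho_1,\sigma_1),(\rho_2,\sigma_2)\in M$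 and $\rho_1\preccurlyeq\rho_2$ then $\sigma_1\sim\sigma_2$. The transformation of a computable measure $\mu$ by a monotone machine $M$ is the function $\mu_M(\sigma):=\mu(\llbracket\{\rho:\exists\sigma'\succcurlyeq\sigma\ ((\rho,\sigma')\in M)\}\rrbracket)$ for $\sigma\in\mathbb{B}^*$. A computable enumeration $\{M_e\}_{e\in\mathbb{N}}$ of all monotone machines is a uniformly c.e. sequence in which exactly the monotone machines occur and which is acceptable: for every uniformly c.e. sequence $\{N_k\}_k$ of monotone machines there is a computable $h:\mathbb{N}\to\mathbb{N}$ with $N_k=M_{h(k)}$ for all $k$. An encoding is a computable sequence $\{\rho_e\}_{e\in\mathbb{N}}$ of pairwise distinct strings in $\mathbb{B}^*$ forming a prefix-free set. A monotone machine $U$ is universal (by adjunction) if for some encoding $\{\rho_e\}_e$ and some computable enumeration $\{M_e\}_e$ of all monotone machines, $(\rho_e\rho,\sigma)\in U\Leftrightarrow(\rho,\sigma)\in M_e$ for all $e,\rho,\sigma$, and every pair in $U$ has a first component of the form $\rho_e\rho$. $U$ is compatible with a measure $\mu$ if such an associated encoding $\{\rho_e\}_e$ can be taken with $\mu(\llbracket\rho_e\rrbracket)>0$ for all $e\in\mathbb{N}$. *)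

theory Defs
  imports
    "HOL-Probability.Probability"
    "HOL-Library.Sublist"
    "HOL-Library.Nat_Bijection"
begin

section \<open>Computability\<close>

text \<open>
  Kleene's class of general recursive functions: the closure of the initial functions under
  composition, primitive recursion and minimization of regular functions.  An \<open>n\<close>-ary function
  is modelled as a function on lists whose values on lists of length other than \<open>n\<close> carry no
  meaning.  Minimization being restricted to regular functions, all members of the class are
  total, and they are exactly the total computable functions.
\<close>

inductive recursive :: "nat \<Rightarrow> (nat list \<Rightarrow> nat) \<Rightarrow> bool" where
  zero: "recursive n (\<lambda>_. 0)"
| succ: "recursive 1 (\<lambda>xs. Suc (hd xs))"
| proj: "i < n \<Longrightarrow> recursive n (\<lambda>xs. xs ! i)"
| comp: "recursive (length gs) f \<Longrightarrow> (\<And>g. g \<in> set gs \<Longrightarrow> recursive n g) \<Longrightarrow>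
    recursive n (\<lambda>xs. f (map (\<lambda>g. g xs) gs))"
| prec: "recursive n f \<Longrightarrow> recursive (Suc (Suc n)) h \<Longrightarrow>
    recursive (Suc n) (\<lambda>xs. rec_nat (f (tl xs)) (\<lambda>i r. h (i # r # tl xs)) (hd xs))"
| mu: "recursive (Suc n) f \<Longrightarrow> (\<And>xs. length xs = n \<Longrightarrow> \<exists>y. f (y # xs) = 0) \<Longrightarrow>
    recursive n (\<lambda>xs. LEAST y. f (y # xs) = 0)"

definition computable :: "(nat \<Rightarrow> nat) \<Rightarrow> bool" where
  "computable f \<longleftrightarrow> (\<exists>F. recursive 1 F \<and> (\<forall>x. f x = F [x]))"

definition ce :: "nat set \<Rightarrow> bool" where
  "ce A \<longleftrightarrow> A = {} \<or> (\<exists>f. computable f \<and> A = range f)"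

text \<open>
  Other domains are reduced to \<^typ>\<open>nat\<close> by effective codings.  For bit strings we use bijective
  base-2 numeration, with the head of the list as least significant digit.
\<close>

fun string_code :: "bool list \<Rightarrow> nat" where
  "string_code [] = 0"
| "string_code (b # \<sigma>) = 2 * string_code \<sigma> + (if b then 2 else 1)"

lemma bij_string_code: "bij string_code"
proof (rule bijI)
  show "inj string_code"
  proof (rule injI)
    fix \<sigma> \<tau> assume "string_code \<sigma> = string_code \<tau>"
    then show "\<sigma> = \<tau>"
    proof (induction \<sigma> arbitrary: \<tau>)
      case Nil
      then show ?case by (cases \<tau>) (auto split: if_splits)
    next
      case (Cons b \<sigma>)
      then obtain c \<upsilon> where \<tau>: "\<tau> = c # \<upsilon>" by (cases \<tau>) (auto split: if_splits)
      with Cons.prems have "2 * string_code \<sigma> + (if b then 2 else 1) =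
        2 * string_code \<upsilon> + (if c then 2 else 1)" by simp
      then have "b = c \<and> string_code \<sigma> = string_code \<upsilon>" by (cases b; cases c; simp; presburger)
      with Cons.IH \<tau> show ?case by simp
    qed
  qed
  have "\<exists>\<sigma>. string_code \<sigma> = n" for n
  proof (induction n rule: less_induct)
    case (less n)
    show ?case
    proof (cases n)
      case 0
      then show ?thesis by (metis string_code.simps(1))
    next
      case (Suc m)
      then obtain \<sigma> where \<sigma>: "string_code \<sigma> = m div 2" using less.IH[of "m div 2"] by (meson div_le_dividend le_imp_less_Suc)
      have "string_code (odd m # \<sigma>) = n"
        using \<sigma> Suc by (cases "odd m") (auto elim!: oddE evenE)
      then show ?thesis by blast
    qed
  qed
  then show "surj string_code" by (metis surjI)
qed

definition pair_code :: "bool list \<times> bool list \<Rightarrow> nat" where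
  "pair_code p = prod_encode (string_code (fst p), string_code (snd p))"

definition rat_decode :: "nat \<Rightarrow> rat" where
  "rat_decode n = (case prod_decode n of (a, b) \<Rightarrow> of_int (int_decode a) / of_nat (Suc b))"

definition computable_strings :: "(nat \<Rightarrow> bool list) \<Rightarrow> bool" where
  "computable_strings \<rho> \<longleftrightarrow> computable (\<lambda>e. string_code (\<rho> e))"

definition computable_rats :: "(bool list \<Rightarrow> nat \<Rightarrow> rat) \<Rightarrow> bool" where
  "computable_rats g \<longleftrightarrow> (\<exists>f. computable f \<and>
     (\<forall>\<sigma> k. g \<sigma> k = rat_decode (f (prod_encode (string_code \<sigma>, k)))))"

definition ce_pairs :: "(bool list \<times> bool list) set \<Rightarrow> bool" where
  "ce_pairs M \<longleftrightarrow> ce (pair_code ` M)"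

definition uniformly_ce :: "(nat \<Rightarrow> (bool list \<times> bool list) set) \<Rightarrow> bool" where
  "uniformly_ce N \<longleftrightarrow> ce {prod_encode (k, pair_code p) |k p. p \<in> N k}"


section \<open>Measures on Cantor space\<close>

text \<open>
  Infinite bit strings are functions \<^typ>\<open>nat \<Rightarrow> bool\<close>; the type carries the product topology of
  the discrete topology on \<^typ>\<open>bool\<close>, so \<^const>\<open>borel\<close> is the Borel algebra of Cantor space.
\<close>

instance bool :: second_countable_topology
proof
  have "countable (UNIV :: bool set set)" by (rule countable_finite) simp
  moreover have "open = generate_topology (UNIV :: bool set set)"
    by (rule ext) (simp add: discrete_topology_class.open_discrete generate_topology.Basis)
  ultimately show "\<exists>B::bool set set. countable B \<and> open = generate_topology B" by blast
qed

definition cylinder :: "bool list \<Rightarrow> (nat \<Rightarrow> bool) set" where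
  "cylinder \<sigma> = {X. \<forall>i < length \<sigma>. X i = \<sigma> ! i}"

definition cylinders :: "bool list set \<Rightarrow> (nat \<Rightarrow> bool) set" where
  "cylinders A = (\<Union>\<sigma>\<in>A. cylinder \<sigma>)"

definition computable_measure :: "(nat \<Rightarrow> bool) measure \<Rightarrow> bool" where
  "computable_measure \<mu> \<longleftrightarrow> prob_space \<mu> \<and> sets \<mu> = sets borel \<and>
     (\<exists>g. computable_rats g \<and>
       (\<forall>\<sigma> k. \<bar>of_rat (g \<sigma> k) - measure \<mu> (cylinder \<sigma>)\<bar> < (1 / 2 :: real) ^ k))"

definition continuous_measure :: "(nat \<Rightarrow> bool) measure \<Rightarrow> bool" where
  "continuous_measure \<mu> \<longleftrightarrow> (\<forall>X. measure \<mu> {X} = 0)"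

definition fair_coin_measure :: "(nat \<Rightarrow> bool) measure" where
  "fair_coin_measure = PiM UNIV (\<lambda>_. measure_pmf (bernoulli_pmf (1 / 2)))"

lemma sets_fair_coin_measure: "sets fair_coin_measure = sets borel"
proof -
  have "sets (borel :: bool measure) = UNIV"
    using sets_borel_eq_count_space by simp
  then have "sets fair_coin_measure = sets (PiM UNIV (\<lambda>_::nat. borel :: bool measure))"
    unfolding fair_coin_measure_def by (intro sets_PiM_cong) auto
  then show ?thesis by (simp add: sets_PiM_equal_borel)
qed

lemma prob_space_fair_coin_measure: "prob_space fair_coin_measure"
  unfolding fair_coin_measure_def
  by (intro prob_space_PiM prob_space_measure_pmf)

lemma fair_coin_measure_cylinder:
  "measure fair_coin_measure (cylinder \<sigma>) = (1 / 2) ^ length \<sigma>"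
proof -
  let ?B = "\<lambda>_::nat. measure_pmf (bernoulli_pmf (1 / 2))"
  interpret product_prob_space ?B UNIV
    by (intro product_prob_spaceI prob_space_measure_pmf)
  have "X \<in> cylinder \<sigma> \<longleftrightarrow>
      X \<in> prod_emb UNIV ?B {..<length \<sigma>} (Pi\<^sub>E {..<length \<sigma>} (\<lambda>i. {\<sigma> ! i}))" for X
    by (simp add: cylinder_def prod_emb_def PiE_iff Pi_iff Ball_def)
  then have "cylinder \<sigma> = prod_emb UNIV ?B {..<length \<sigma>} (Pi\<^sub>E {..<length \<sigma>} (\<lambda>i. {\<sigma> ! i}))"
    by (rule set_eqI)
  then have "measure fair_coin_measure (cylinder \<sigma>) =
      (\<Prod>i<length \<sigma>. measure (?B i) {\<sigma> ! i})"
    unfolding fair_coin_measure_def by (simp only: measure_PiM_emb[OF subset_UNIV finite_lessThan] sets_measure_pmf UNIV_I)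
  also have "\<dots> = (\<Prod>i<length \<sigma>. 1 / 2)"
  proof (rule prod.cong)
    show "measure (?B i) {\<sigma> ! i} = 1 / 2" for i
      by (cases "\<sigma> ! i") (simp_all add: measure_pmf_single)
  qed simp
  finally show ?thesis by (simp add: power_divide)
qed


section \<open>Monotone machines\<close>

definition comparable :: "bool list \<Rightarrow> bool list \<Rightarrow> bool" where
  "comparable \<sigma> \<tau> \<longleftrightarrow> prefix \<sigma> \<tau> \<or> prefix \<tau> \<sigma>"

definition monotone_machine :: "(bool list \<times> bool list) set \<Rightarrow> bool" where
  "monotone_machine M \<longleftrightarrow> ce_pairs M \<and>
     (\<forall>\<rho>\<^sub>1 \<sigma>\<^sub>1 \<rho>\<^sub>2 \<sigma>\<^sub>2. (\<rho>\<^sub>1, \<sigma>\<^sub>1) \<in> M \<and> (\<rho>\<^sub>2, \<sigma>\<^sub>2) \<in> M \<and> prefix \<rho>\<^sub>1 \<rho>\<^sub>2 \<longrightarrow> comparable \<sigma>\<^sub>1 \<sigma>\<^sub>2)"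

definition transformation ::
  "(nat \<Rightarrow> bool) measure \<Rightarrow> (bool list \<times> bool list) set \<Rightarrow> bool list \<Rightarrow> real" where
  "transformation \<mu> M \<sigma> = measure \<mu> (cylinders {\<rho>. \<exists>\<sigma>'. prefix \<sigma> \<sigma>' \<and> (\<rho>, \<sigma>') \<in> M})"

definition machine_enumeration :: "(nat \<Rightarrow> (bool list \<times> bool list) set) \<Rightarrow> bool" where
  "machine_enumeration M \<longleftrightarrow> uniformly_ce M \<and> range M = {N. monotone_machine N} \<and>
     (\<forall>N. uniformly_ce N \<and> (\<forall>k. monotone_machine (N k)) \<longrightarrow>
        (\<exists>h. computable h \<and> (\<forall>k. N k = M (h k))))"

definition encoding :: "(nat \<Rightarrow> bool list) \<Rightarrow> bool" where
  "encoding \<rho> \<longleftrightarrow> computable_strings \<rho> \<and> inj \<rho> \<and>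
     (\<forall>\<sigma>\<in>range \<rho>. \<forall>\<tau>\<in>range \<rho>. prefix \<sigma> \<tau> \<longrightarrow> \<sigma> = \<tau>)"

definition universal_via :: "(bool list \<times> bool list) set \<Rightarrow> (nat \<Rightarrow> bool list) \<Rightarrow> bool" where
  "universal_via U \<rho> \<longleftrightarrow> encoding \<rho> \<and>
     (\<exists>M. machine_enumeration M \<and>
       (\<forall>e \<pi> \<sigma>. (\<rho> e @ \<pi>, \<sigma>) \<in> U \<longleftrightarrow> (\<pi>, \<sigma>) \<in> M e) \<and>
       (\<forall>(\<tau>, \<sigma>) \<in> U. \<exists>e \<pi>. \<tau> = \<rho> e @ \<pi>))"

definition universal_machine :: "(bool list \<times> bool list) set \<Rightarrow> bool" where
  "universal_machine U \<longleftrightarrow> monotone_machine U \<and> (\<exists>\<rho>. universal_via U \<rho>)"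

definition compatible :: "(bool list \<times> bool list) set \<Rightarrow> (nat \<Rightarrow> bool) measure \<Rightarrow> bool" where
  "compatible U \<mu> \<longleftrightarrow> (\<exists>\<rho>. universal_via U \<rho> \<and> (\<forall>e. measure \<mu> (cylinder (\<rho> e)) > 0))"

definition apriori_semimeasures :: "(bool list \<Rightarrow> real) set" where
  "apriori_semimeasures = {transformation fair_coin_measure V |V. universal_machine V}"

end

theory Submission
  imports Defs
begin

text \<open>
  For an atomless measure \<open>\<mu>\<close>, the lexicographic distribution function maps \<open>\<mu>\<close> to the uniform
  distribution on the unit interval, and each string \<open>\<sigma>\<close> to an interval of length
  \<open>\<mu> (cylinder \<sigma>)\<close>.  Given a machine \<open>M\<close>, read by \<open>\<mu>\<close>, let a string \<open>\<pi>\<close> produce \<open>\<sigma>\<close> whenever the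
  \<open>\<nu>\<close>-interval of \<open>\<pi>\<close> lies strictly inside the \<open>\<mu>\<close>-interval of some \<open>\<rho>\<close> with \<open>(\<rho>, \<sigma>) \<in> M\<close>.  This is
  again a monotone machine, and its transformation of \<open>\<nu>\<close> is the transformation of \<open>\<mu>\<close> by \<open>M\<close>.

  Both inclusions are instances of one claim: if \<open>U\<close> is universal via \<open>\<rho>\<close> and compatible with \<open>\<mu>\<close>, its
  transformation of \<open>\<mu>\<close> is that of \<open>\<nu>\<close> by a universal machine compatible with \<open>\<nu>\<close>.  Uniformly in
  \<open>k\<close>, choose a string \<open>\<theta> k\<close> whose \<open>\<nu>\<close>-interval lies inside the \<open>\<mu>\<close>-interval of \<open>\<rho> k\<close>, and a universal
  machine \<open>V\<^sub>0 k\<close> with all its codewords above \<open>\<theta> k\<close>.  By the recursion theorem there is a \<open>k\<close> such that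
  the part of \<open>U\<close> above \<open>\<rho> k\<close> is precisely \<open>V\<^sub>0 k\<close> transported from \<open>\<nu>\<close> to \<open>\<mu>\<close>.  The rest of \<open>U\<close>,
  transported from \<open>\<mu>\<close> to \<open>\<nu>\<close>, lives outside \<open>\<theta> k\<close>, where the finitely many siblings of the prefixes of
  \<open>\<theta> k\<close> serve as additional codewords.
\<close>

section \<open>Computable functions\<close>

text \<open>Membership in \<open>recursive\<close> also depends on the values at lists of the wrong
  length. Asking only for agreement on lists of length \<open>n\<close> permits rewriting a function
  by its values there.\<close>

definition rec_on :: "nat \<Rightarrow> (nat list \<Rightarrow> nat) \<Rightarrow> bool" where
  "rec_on n f \<longleftrightarrow> (\<exists>F. recursive n F \<and> (\<forall>xs. length xs = n \<longrightarrow> f xs = F xs))"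

lemma rec_on_comp:
  assumes "rec_on (length gs) f" "\<And>g. g \<in> set gs \<Longrightarrow> rec_on n g"
  shows "rec_on n (\<lambda>xs. f (map (\<lambda>g. g xs) gs))"
proof -
  obtain F where F: "recursive (length gs) F" "\<And>xs. length xs = length gs \<Longrightarrow> f xs = F xs"
    using assms(1) unfolding rec_on_def by blast
  have "\<forall>g\<in>set gs. \<exists>G. recursive n G \<and> (\<forall>xs. length xs = n \<longrightarrow> g xs = G xs)"
    using assms(2) unfolding rec_on_def by blast
  then obtain G where G: "\<And>g. g \<in> set gs \<Longrightarrow> recursive n (G g)"
      "\<And>g xs. g \<in> set gs \<Longrightarrow> length xs = n \<Longrightarrow> g xs = G g xs"
    by (metis (no_types, lifting))
  have "recursive n (\<lambda>xs. F (map (\<lambda>g. g xs) (map G gs)))"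
    by (rule recursive.comp) (use F(1) G(1) in auto)
  moreover have "f (map (\<lambda>g. g xs) gs) = F (map (\<lambda>g. g xs) (map G gs))" if "length xs = n" for xs
  proof -
    have "map (\<lambda>g. g xs) gs = map (\<lambda>g. g xs) (map G gs)"
      using G(2)[OF _ that] by simp
    then show ?thesis using F(2) by (metis length_map)
  qed
  ultimately show ?thesis unfolding rec_on_def by blast
qed

lemma rec_on_cong:
  assumes "rec_on n f" "\<And>xs. length xs = n \<Longrightarrow> f xs = g xs"
  shows "rec_on n g"
  using assms unfolding rec_on_def by (metis (no_types, lifting))

lemma rec_on_nth: "i < n \<Longrightarrow> rec_on n (\<lambda>xs. xs ! i)"
  unfolding rec_on_def using recursive.proj by blast

lemma computable_iff_rec_on: "computable f \<longleftrightarrow> rec_on 1 (\<lambda>xs. f (xs ! 0))"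
proof
  assume "computable f"
  then obtain F where "recursive 1 F" "\<And>x. f x = F [x]" unfolding computable_def by blast
  then show "rec_on 1 (\<lambda>xs. f (xs ! 0))"
    unfolding rec_on_def by (intro exI[of _ F]) (auto simp: length_Suc_conv)
next
  assume "rec_on 1 (\<lambda>xs. f (xs ! 0))"
  then obtain F where "recursive 1 F" "\<And>xs. length xs = 1 \<Longrightarrow> f (xs ! 0) = F xs"
    unfolding rec_on_def by blast
  then show "computable f"
    unfolding computable_def by (intro exI[of _ F]) (metis One_nat_def length_Cons list.size(3) nth_Cons_0)
qed

lemma rec_on_comp1:
  assumes "computable h" "rec_on n f"
  shows "rec_on n (\<lambda>xs. h (f xs))"
  using rec_on_comp[of "[f]" "\<lambda>xs. h (xs ! 0)" n] assms by (auto simp: computable_iff_rec_on)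

lemma rec_on_comp2:
  assumes "rec_on 2 (\<lambda>xs. h (xs ! 0) (xs ! 1))" "rec_on n f" "rec_on n g"
  shows "rec_on n (\<lambda>xs. h (f xs) (g xs))"
  using rec_on_comp[of "[f, g]" "\<lambda>xs. h (xs ! 0) (xs ! 1)" n] assms
  by (auto simp: numeral_2_eq_2)

lemma rec_on_rec_nat:
  assumes "rec_on n a" "rec_on (Suc (Suc n)) h"
  shows "rec_on (Suc n) (\<lambda>xs. rec_nat (a (tl xs)) (\<lambda>i r. h (i # r # tl xs)) (xs ! 0))"
proof -
  obtain A where A: "recursive n A" "\<And>xs. length xs = n \<Longrightarrow> a xs = A xs"
    using assms(1) unfolding rec_on_def by blast
  obtain H where H: "recursive (Suc (Suc n)) H" "\<And>xs. length xs = Suc (Suc n) \<Longrightarrow> h xs = H xs"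
    using assms(2) unfolding rec_on_def by blast
  have "rec_nat (a (tl xs)) (\<lambda>i r. h (i # r # tl xs)) (xs ! 0) =
        rec_nat (A (tl xs)) (\<lambda>i r. H (i # r # tl xs)) (hd xs)" if "length xs = Suc n" for xs
  proof -
    have "(\<lambda>i r. h (i # r # tl xs)) = (\<lambda>i r. H (i # r # tl xs))"
      using that H(2) by auto
    moreover have "a (tl xs) = A (tl xs)" using that A(2) by simp
    moreover have "hd xs = xs ! 0" using that by (cases xs) auto
    ultimately show ?thesis by simp
  qed
  then show ?thesis unfolding rec_on_def using recursive.prec[OF A(1) H(1)] by blast
qed

lemma rec_on_Least:
  assumes "rec_on (Suc n) f" "\<And>xs. length xs = n \<Longrightarrow> \<exists>y. f (y # xs) = 0"
  shows "rec_on n (\<lambda>xs. LEAST y. f (y # xs) = 0)"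
proof -
  obtain F where F: "recursive (Suc n) F" "\<And>xs. length xs = Suc n \<Longrightarrow> f xs = F xs"
    using assms(1) unfolding rec_on_def by blast
  have "recursive n (\<lambda>xs. LEAST y. F (y # xs) = 0)"
    by (rule recursive.mu[OF F(1)]) (use assms(2) F(2) in \<open>metis length_Cons\<close>)
  then show ?thesis unfolding rec_on_def using F(2) by (intro exI conjI) (assumption, auto)
qed

section \<open>Unary computable functions: arithmetic and Cantor pairing\<close>

named_theorems computable_intros

lemma computable_id [computable_intros]: "computable (\<lambda>x. x)"
  by (simp add: computable_iff_rec_on rec_on_nth)

lemma computable_comp:
  "computable f \<Longrightarrow> computable g \<Longrightarrow> computable (\<lambda>x. f (g x))"
  using rec_on_comp1[of f 1 "\<lambda>xs. g (xs ! 0)"] by (simp add: computable_iff_rec_on)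

lemma computable_comp2:
  "rec_on 2 (\<lambda>xs. h (xs ! 0) (xs ! 1)) \<Longrightarrow> computable f \<Longrightarrow> computable g \<Longrightarrow>
    computable (\<lambda>x. h (f x) (g x))"
  using rec_on_comp2[of h 1 "\<lambda>xs. f (xs ! 0)" "\<lambda>xs. g (xs ! 0)"]
  by (simp add: computable_iff_rec_on)

lemma computable_Suc [computable_intros]:
  assumes "computable f" shows "computable (\<lambda>x. Suc (f x))"
proof -
  have "computable Suc" unfolding computable_def using recursive.succ by force
  then show ?thesis using assms by (rule computable_comp)
qed

lemma rec_on_const: "rec_on n (\<lambda>_. c)"
proof (induction c)
  case 0
  then show ?case unfolding rec_on_def using recursive.zero by blast
next
  case (Suc c)
  show ?case by (rule rec_on_comp1[OF computable_Suc[OF computable_id] Suc])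
qed

lemma computable_const [computable_intros]: "computable (\<lambda>_. c)"
  by (simp add: computable_iff_rec_on rec_on_const)

text \<open>Recursion runs on the first argument with the second as parameter. As \<open>G\<close>
  enters through a pointwise equation, each use only has to verify that equation.\<close>

lemma rec_on_2_rec_nat:
  assumes "rec_on 1 a" "rec_on 3 h"
    and G: "\<And>x y. G x y = rec_nat (a [y]) (\<lambda>i r. h [i, r, y]) x"
  shows "rec_on 2 (\<lambda>xs. G (xs ! 0) (xs ! 1))"
proof -
  have "rec_on 2 (\<lambda>xs. rec_nat (a (tl xs)) (\<lambda>i r. h (i # r # tl xs)) (xs ! 0))"
    using rec_on_rec_nat[of 1 a h] assms(1,2) by (simp add: numeral_2_eq_2 numeral_3_eq_3)
  then show ?thesis
    by (rule rec_on_cong) (auto simp: G numeral_2_eq_2 length_Suc_conv)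
qed

lemma rec_on_add: "rec_on 2 (\<lambda>xs. xs ! 0 + xs ! 1)"
proof (rule rec_on_2_rec_nat)
  show "rec_on 3 (\<lambda>xs. Suc (xs ! 1))"
    by (intro rec_on_nth rec_on_comp1[OF computable_Suc[OF computable_id]]) auto
  show "x + y = rec_nat ([y] ! 0) (\<lambda>i r. Suc ([i, r, y] ! 1)) x" for x y
    by (induction x) auto
qed (simp add: rec_on_nth)

lemmas computable_add [computable_intros] = computable_comp2[OF rec_on_add]

lemma rec_on_mult: "rec_on 2 (\<lambda>xs. xs ! 0 * xs ! 1)"
proof (rule rec_on_2_rec_nat)
  show "rec_on 3 (\<lambda>xs. xs ! 1 + xs ! 2)"
    by (intro rec_on_nth rec_on_comp2[OF rec_on_add]) auto
  show "x * y = rec_nat 0 (\<lambda>i r. [i, r, y] ! 1 + [i, r, y] ! 2) x" for x y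
    by (induction x) auto
qed (rule rec_on_const)

lemmas computable_mult [computable_intros] = computable_comp2[OF rec_on_mult]

lemma computable_pred: "computable (\<lambda>x. x - 1)"
proof -
  have "rec_on (Suc 0) (\<lambda>xs. rec_nat 0 (\<lambda>i r. (i # r # tl xs) ! 0) (xs ! 0))"
    by (intro rec_on_rec_nat rec_on_nth rec_on_const) auto
  then have "computable (\<lambda>x. rec_nat 0 (\<lambda>i r. i) x)"
    by (simp add: computable_iff_rec_on)
  moreover have "rec_nat 0 (\<lambda>i r. i) x = x - 1" for x :: nat by (cases x) auto
  ultimately show ?thesis by simp
qed

lemma rec_on_diff: "rec_on 2 (\<lambda>xs. xs ! 0 - xs ! 1)"
proof -
  \<comment> \<open>The subtrahend counts the predecessor steps, so it has to be the recursion
    argument; the order is swapped back afterwards.\<close>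
  have "rec_on 2 (\<lambda>xs. (\<lambda>x y. y - x) (xs ! 0) (xs ! 1))"
  proof (rule rec_on_2_rec_nat)
    show "rec_on 3 (\<lambda>xs. xs ! 1 - 1)"
      by (intro rec_on_nth rec_on_comp1[OF computable_pred]) auto
    show "y - x = rec_nat ([y] ! 0) (\<lambda>i r. [i, r, y] ! 1 - 1) x" for x y
      by (induction x) auto
  qed (simp add: rec_on_nth)
  from rec_on_comp2[OF this, of 2 "\<lambda>xs. xs ! 1" "\<lambda>xs. xs ! 0"] show ?thesis
    by (simp add: rec_on_nth)
qed

lemmas computable_diff [computable_intros] = computable_comp2[OF rec_on_diff]

lemma computable_triangle: 
  assumes "computable f" shows "computable (\<lambda>x. triangle (f x))"
proof -
  have "rec_on (Suc 0) (\<lambda>xs. rec_nat 0 (\<lambda>i r. (i # r # tl xs) ! 1 + Suc ((i # r # tl xs) ! 0)) (xs ! 0))"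
    by (intro rec_on_rec_nat rec_on_nth rec_on_const rec_on_comp2[OF rec_on_add]
        rec_on_comp1[OF computable_Suc[OF computable_id]]) auto
  then have "computable (\<lambda>x. rec_nat 0 (\<lambda>i r. r + Suc i) x)"
    by (simp add: computable_iff_rec_on)
  moreover have "rec_nat 0 (\<lambda>i r. r + Suc i) x = triangle x" for x :: nat
    by (induction x) auto
  then have "(\<lambda>x. rec_nat 0 (\<lambda>i r. r + Suc i) x) = triangle" by (rule ext)
  ultimately have "computable triangle" by (rule back_subst[of computable])
  then show ?thesis using assms by (rule computable_comp)
qed

lemma rec_on_prod_encode: "rec_on 2 (\<lambda>xs. prod_encode (xs ! 0, xs ! 1))"
proof -
  have "computable triangle" using computable_triangle[OF computable_id] by simp
  then show ?thesis unfolding prod_encode_def case_prod_conv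
    by (intro rec_on_comp2[OF rec_on_add] rec_on_comp1[of triangle] rec_on_nth) auto
qed

lemma computable_prod_encode [computable_intros]:
  "computable f \<Longrightarrow> computable g \<Longrightarrow> computable (\<lambda>x. prod_encode (f x, g x))"
  using computable_comp2[of "\<lambda>x y. prod_encode (x, y)", OF rec_on_prod_encode] .

text \<open>The Cantor pair \<open>z\<close> lies on the diagonal \<open>s\<close> with
  \<open>triangle s \<le> z < triangle (Suc s)\<close>.\<close>

lemma prod_decode_diagonal:
  defines "s \<equiv> (\<lambda>z. fst (prod_decode z) + snd (prod_decode z))"
  shows "z = triangle (s z) + fst (prod_decode z)"
    and "s z = (LEAST y. Suc z - triangle (Suc y) = 0)"
proof -
  show 1: "z = triangle (s z) + fst (prod_decode z)"
    unfolding s_def by (metis (no_types, lifting) prod_decode_inverse prod_encode_def case_prod_beta)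
  show "s z = (LEAST y. Suc z - triangle (Suc y) = 0)"
  proof (rule Least_equality[symmetric])
    show "Suc z - triangle (Suc (s z)) = 0" using 1 unfolding s_def triangle_Suc by linarith
    fix y assume "Suc z - triangle (Suc y) = 0"
    then have *: "z < triangle (Suc y)" by linarith
    have mono: "a \<le> b \<Longrightarrow> triangle a \<le> triangle b" for a b
      by (induction b) (auto simp: le_Suc_eq)
    show "s z \<le> y"
      using mono[of "Suc y" "s z"] 1 * by (metis le_add1 not_less_eq_eq order_trans leD)
  qed
qed

lemma computable_prod_decode_sum:
  "computable (\<lambda>z. fst (prod_decode z) + snd (prod_decode z))"
proof -
  have t: "computable (\<lambda>y. triangle (Suc y))" "computable Suc"
    using computable_triangle[OF computable_Suc[OF computable_id]] computable_Suc[OF computable_id]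
    by auto
  have "rec_on (Suc 1) (\<lambda>xs. Suc (xs ! 1) - triangle (Suc (xs ! 0)))"
    by (intro rec_on_comp2[OF rec_on_diff] rec_on_comp1[OF t(1)] rec_on_comp1[OF t(2)] rec_on_nth) auto
  moreover have "\<exists>y. Suc (xs ! 0) - triangle (Suc y) = 0" for xs
    by (rule exI[of _ "xs ! 0"]) (simp)
  ultimately have "rec_on 1 (\<lambda>xs. LEAST y. Suc (xs ! 0) - triangle (Suc y) = 0)"
    using rec_on_Least[of 1 "\<lambda>xs. Suc (xs ! 1) - triangle (Suc (xs ! 0))"] by simp
  then show ?thesis
    unfolding computable_iff_rec_on prod_decode_diagonal(2) .
qed

lemma computable_fst_prod_decode [computable_intros]:
  assumes "computable f" shows "computable (\<lambda>x. fst (prod_decode (f x)))"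
proof -
  have "fst (prod_decode z) = z - triangle (fst (prod_decode z) + snd (prod_decode z))" for z
    using prod_decode_diagonal(1)[of z] by linarith
  moreover have "computable (\<lambda>z. z - triangle (fst (prod_decode z) + snd (prod_decode z)))"
    by (intro computable_intros computable_triangle computable_prod_decode_sum)
  ultimately have "computable (\<lambda>z. fst (prod_decode z))" by simp
  then show ?thesis using assms by (rule computable_comp)
qed

lemma computable_snd_prod_decode [computable_intros]:
  assumes "computable f" shows "computable (\<lambda>x. snd (prod_decode (f x)))"
proof -
  have "computable (\<lambda>z. (fst (prod_decode z) + snd (prod_decode z)) - fst (prod_decode z))"
    by (rule computable_diff[OF computable_prod_decode_sum]) (intro computable_intros)
  then have "computable (\<lambda>z. snd (prod_decode z))" by simp
  then show ?thesis using assms by (rule computable_comp)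
qed

section \<open>Recursion and search with a parameter\<close>

text \<open>The step function takes its three arguments as nested Cantor pairs, so only unary
  computability is mentioned. The recursion is binary, in counter and parameter, before
  \<open>b x\<close> and \<open>x\<close> are substituted.\<close>

lemma computable_rec_nat:
  assumes a: "computable a" and b: "computable b"
    and h: "computable (\<lambda>z. h (fst (prod_decode z)) (fst (prod_decode (snd (prod_decode z))))
                               (snd (prod_decode (snd (prod_decode z)))))"
  shows "computable (\<lambda>x. rec_nat (a x) (\<lambda>i r. h i r x) (b x))"
proof -
  have e: "rec_on n f \<Longrightarrow> rec_on n g \<Longrightarrow> rec_on n (\<lambda>xs. prod_encode (f xs, g xs))" for n f g
    using rec_on_comp2[of "\<lambda>x y. prod_encode (x, y)", OF rec_on_prod_encode] .
  let ?H = "\<lambda>z. h (fst (prod_decode z)) (fst (prod_decode (snd (prod_decode z))))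
                               (snd (prod_decode (snd (prod_decode z))))"
  have "rec_on (Suc (Suc 1)) (\<lambda>xs. ?H (prod_encode (xs ! 0, prod_encode (xs ! 1, xs ! 2))))"
    by (rule rec_on_comp1[OF h]) (intro e rec_on_nth; simp)
  then have "rec_on (Suc 1) (\<lambda>xs. rec_nat (a (tl xs ! 0)) (\<lambda>i r. ?H (prod_encode ((i # r # tl xs) ! 0,
      prod_encode ((i # r # tl xs) ! 1, (i # r # tl xs) ! 2)))) (xs ! 0))"
    by (intro rec_on_rec_nat rec_on_comp1[OF a] rec_on_nth) auto
  then have *: "rec_on 2 (\<lambda>xs. rec_nat (a (xs ! 1)) (\<lambda>i r. h i r (xs ! 1)) (xs ! 0))"
    unfolding numeral_2_eq_2 One_nat_def by (rule rec_on_cong) (simp add: nth_tl)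
  show ?thesis
    using computable_comp2[of "\<lambda>y x. rec_nat (a x) (\<lambda>i r. h i r x) y", OF * b computable_id] .
qed

lemma computable_Least_zero:
  assumes f: "computable (\<lambda>z. f (fst (prod_decode z)) (snd (prod_decode z)))"
    and ex: "\<And>x. \<exists>y. f x y = (0::nat)"
  shows "computable (\<lambda>x. LEAST y. f x y = 0)"
proof -
  let ?F = "\<lambda>z. f (fst (prod_decode z)) (snd (prod_decode z))"
  have "rec_on (Suc 1) (\<lambda>xs. ?F (prod_encode (xs ! 1, xs ! 0)))"
    by (rule rec_on_comp1[OF f], rule rec_on_comp2[of "\<lambda>x y. prod_encode (x, y)", OF rec_on_prod_encode])
      (simp_all add: rec_on_nth)
  then have "rec_on 1 (\<lambda>xs. LEAST y. f (xs ! 0) y = 0)"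
    using rec_on_Least[of 1 "\<lambda>xs. ?F (prod_encode (xs ! 1, xs ! 0))"] ex by simp
  then show ?thesis unfolding computable_iff_rec_on .
qed

lemma computable_sum [computable_intros]:
  assumes "computable (\<lambda>z. f (fst (prod_decode z)) (snd (prod_decode z)))" "computable m"
  shows "computable (\<lambda>x. \<Sum>i<m x. f x i)"
proof -
  have "computable (\<lambda>x. rec_nat 0 (\<lambda>i r. r + f x i) (m x))"
  proof (intro computable_rec_nat computable_intros assms)
    \<comment> \<open>In the coded triple of counter, accumulator and parameter, \<open>x\<close>
      comes last and \<open>i\<close> first, hence the swap.\<close>
    from computable_comp[OF assms(1), of "\<lambda>z. prod_encode (snd (prod_decode (snd (prod_decode z))), fst (prod_decode z))"]
    show "computable (\<lambda>z. f (snd (prod_decode (snd (prod_decode z)))) (fst (prod_decode z)))"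
      by (simp add: computable_intros)
  qed
  moreover have "rec_nat 0 (\<lambda>i r. r + f x i) n = (\<Sum>i<n. f x i)" for x n
    by (induction n) auto
  ultimately show ?thesis by simp
qed

lemma computable_power [computable_intros]:
  assumes "computable f" "computable g"
  shows "computable (\<lambda>x. f x ^ g x)"
proof -
  have "computable (\<lambda>x. rec_nat 1 (\<lambda>i r. f x * r) (g x))"
    by (intro computable_rec_nat computable_intros assms computable_comp[OF assms(1)])
  moreover have "rec_nat 1 (\<lambda>i r. f x * r) n = f x ^ n" for x n
    by (induction n) auto
  ultimately show ?thesis by simp
qed

section \<open>Decidable predicates, case distinction and division\<close>

definition decidable :: "(nat \<Rightarrow> bool) \<Rightarrow> bool" where
  "decidable P \<longleftrightarrow> computable (\<lambda>x. of_bool (P x))"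

lemma decidable_comp: "decidable P \<Longrightarrow> computable f \<Longrightarrow> decidable (\<lambda>x. P (f x))"
  unfolding decidable_def by (rule computable_comp)

lemma decidable_le [computable_intros]:
  assumes "computable f" "computable g" shows "decidable (\<lambda>x. f x \<le> g x)"
proof -
  have "computable (\<lambda>x. 1 - (f x - g x))" by (intro computable_intros assms)
  moreover have "1 - (f x - g x) = of_bool (f x \<le> g x)" for x by auto
  ultimately show ?thesis unfolding decidable_def by simp
qed

lemma decidable_not [computable_intros]:
  assumes "decidable P" shows "decidable (\<lambda>x. \<not> P x)"
proof -
  have "computable (\<lambda>x. 1 - of_bool (P x))"
    by (intro computable_intros assms[unfolded decidable_def])
  moreover have "1 - of_bool (P x) = (of_bool (\<not> P x) :: nat)" for x by auto
  ultimately show ?thesis unfolding decidable_def by simp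
qed

lemma decidable_conj [computable_intros]:
  assumes "decidable P" "decidable Q" shows "decidable (\<lambda>x. P x \<and> Q x)"
  using computable_mult[OF assms[unfolded decidable_def]]
  unfolding decidable_def by (simp add: of_bool_conj)

lemma decidable_less [computable_intros]:
  "computable f \<Longrightarrow> computable g \<Longrightarrow> decidable (\<lambda>x. f x < g x)"
  unfolding not_le[symmetric] by (intro computable_intros)

lemma decidable_eq [computable_intros]:
  "computable f \<Longrightarrow> computable g \<Longrightarrow> decidable (\<lambda>x. f x = (g x :: nat))"
  unfolding eq_iff by (intro computable_intros)

lemma computable_if [computable_intros]:
  assumes "decidable P" "computable f" "computable g"
  shows "computable (\<lambda>x. if P x then f x else g x)"
proof -
  have "computable (\<lambda>x. of_bool (P x) * f x + (1 - of_bool (P x)) * g x)"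
    by (intro computable_intros assms assms(1)[unfolded decidable_def])
  moreover have "of_bool (P x) * f x + (1 - of_bool (P x)) * g x = (if P x then f x else g x)" for x
    by auto
  ultimately show ?thesis by simp
qed

lemma computable_Least:
  assumes P: "decidable (\<lambda>z. P (fst (prod_decode z)) (snd (prod_decode z)))"
    and ex: "\<And>x. \<exists>y. P x y"
  shows "computable (\<lambda>x. LEAST y. P x y)"
proof -
  have "computable (\<lambda>x. LEAST y. (if P x y then 0 else 1::nat) = 0)"
    by (rule computable_Least_zero) (intro computable_intros P, use ex in auto)
  then show ?thesis by (simp split: if_splits)
qed

lemma computable_div [computable_intros]:
  assumes "computable f" "computable g" shows "computable (\<lambda>x. f x div g x)"
proof -
  \<comment> \<open>The alternative \<open>g x = 0\<close> keeps the search total; it then stops at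
    0, the value of division by zero.\<close>
  have "computable (\<lambda>x. LEAST q. f x < Suc q * g x \<or> g x = 0)"
  proof (rule computable_Least)
    show "decidable (\<lambda>z. f (fst (prod_decode z)) < Suc (snd (prod_decode z)) * g (fst (prod_decode z)) \<or>
                 g (fst (prod_decode z)) = 0)"
      \<comment> \<open>Disjunction is reduced to the closure rules for negation and
        conjunction.\<close>
      unfolding de_Morgan_conj[of "\<not> _" "\<not> _", symmetric, unfolded not_not]
      by (intro computable_intros computable_comp[OF assms(1)] computable_comp[OF assms(2)])
    show "\<exists>q. f x < Suc q * g x \<or> g x = 0" for x
      by (metis dividend_less_div_times mult.commute mult_Suc not_gr_zero add.commute)
  qed
  moreover have "(LEAST q. m < Suc q * n \<or> n = 0) = m div n" for m n :: nat
  proof (rule Least_equality)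
    show "m < Suc (m div n) * n \<or> n = 0"
      by (metis dividend_less_div_times mult.commute mult_Suc not_gr_zero add.commute)
    show "m div n \<le> q" if "m < Suc q * n \<or> n = 0" for q
      using that by (metis div_by_0 le0 less_Suc_eq_le less_mult_imp_div_less)
  qed
  ultimately show ?thesis by simp
qed

lemma computable_mod [computable_intros]:
  assumes "computable f" "computable g" shows "computable (\<lambda>x. f x mod g x)"
proof -
  have "computable (\<lambda>x. f x - f x div g x * g x)" by (intro computable_intros assms)
  then show ?thesis by (simp add: minus_div_mult_eq_mod)
qed

lemma computable_case_nat [computable_intros]:
  assumes "computable f" shows "computable (case_nat c f)"
proof -
  have "computable (\<lambda>x. if x = 0 then c else f (x - 1))"
    by (intro computable_intros computable_comp[OF assms])
  moreover have "(if x = 0 then c else f (x - 1)) = case_nat c f x" for x by (cases x) auto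
  ultimately show ?thesis by simp
qed

section \<open>Bit strings as numbers\<close>

definition string_decode :: "nat \<Rightarrow> bool list" where
  "string_decode = inv string_code"

lemma string_code_string_decode [simp]: "string_code (string_decode n) = n"
  unfolding string_decode_def by (rule surj_f_inv_f[OF bij_is_surj[OF bij_string_code]])

lemma string_decode_string_code [simp]: "string_decode (string_code \<sigma>) = \<sigma>"
  unfolding string_decode_def by (rule inv_f_f[OF bij_is_inj[OF bij_string_code]])

lemma string_code_eq_iff [simp]: "string_code \<sigma> = string_code \<tau> \<longleftrightarrow> \<sigma> = \<tau>"
  by (metis string_decode_string_code)

lemma ex_string_decode: "(\<exists>\<sigma>. P \<sigma>) \<longleftrightarrow> (\<exists>y. P (string_decode y))"
proof
  assume "\<exists>\<sigma>. P \<sigma>"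
  then obtain \<sigma> where "P \<sigma>" by blast
  then have "P (string_decode (string_code \<sigma>))" by simp
  then show "\<exists>y. P (string_decode y)" by (rule exI)
qed blast

text \<open>The head is the least significant digit, so the digits of the second string are shifted
  by the length of the first.\<close>

lemma string_code_append: "string_code (\<sigma> @ \<tau>) = string_code \<sigma> + 2 ^ length \<sigma> * string_code \<tau>"
  by (induction \<sigma>) (auto simp: algebra_simps)

text \<open>These bounds determine the length as a least exponent, which
  \<open>computable_length\<close> finds by search.\<close>

lemma string_code_bounds:
  "2 ^ length \<sigma> \<le> Suc (string_code \<sigma>)" "Suc (string_code \<sigma>) < 2 ^ Suc (length \<sigma>)"
  by (induction \<sigma>) auto

lemma computable_string_decode [computable_intros]:
  "computable f \<Longrightarrow> computable (\<lambda>x. string_code (string_decode (f x)))"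
  by simp

lemma computable_length [computable_intros]:
  assumes "computable (\<lambda>x. string_code (f x))"
  shows "computable (\<lambda>x. length (f x))"
proof -
  have "length \<sigma> = (LEAST n. Suc (string_code \<sigma>) < 2 ^ Suc n)" for \<sigma>
  proof (rule Least_equality[symmetric])
    fix n assume "Suc (string_code \<sigma>) < 2 ^ Suc n"
    with string_code_bounds(1)[of \<sigma>] have "(2::nat) ^ length \<sigma> < 2 ^ Suc n" by linarith
    then have "length \<sigma> < Suc n" by (rule power_less_imp_less_exp[rotated]) simp
    then show "length \<sigma> \<le> n" by simp
  qed (rule string_code_bounds(2))
  moreover have "computable (\<lambda>x. LEAST n. Suc (string_code (f x)) < 2 ^ Suc n)"
  proof (rule computable_Least)
    show "decidable (\<lambda>z. Suc (string_code (f (fst (prod_decode z)))) < 2 ^ Suc (snd (prod_decode z)))"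
      by (intro computable_intros computable_comp[OF assms])
    show "\<exists>y. Suc (string_code (f x)) < 2 ^ Suc y" for x
      using string_code_bounds(2) by blast
  qed
  ultimately show ?thesis by simp
qed

lemma computable_append [computable_intros]:
  "computable (\<lambda>x. string_code (f x)) \<Longrightarrow> computable (\<lambda>x. string_code (g x)) \<Longrightarrow>
    computable (\<lambda>x. string_code (f x @ g x))"
  unfolding string_code_append by (intro computable_intros)

text \<open>By the formula for appending, a prefix is recognized by divisibility: the difference of
  the codes, divided by the power of 2 belonging to the first string, is the code of the remaining
  suffix, and every number is a code.\<close>

lemma decidable_prefix [computable_intros]:
  assumes "computable (\<lambda>x. string_code (f x))" "computable (\<lambda>x. string_code (g x))"
  shows "decidable (\<lambda>x. prefix (f x) (g x))"
proof -
  have "prefix \<sigma> \<tau> \<longleftrightarrow> string_code \<sigma> \<le> string_code \<tau> \<and>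
      (string_code \<tau> - string_code \<sigma>) mod 2 ^ length \<sigma> = 0" (is "?l \<longleftrightarrow> ?r") for \<sigma> \<tau>
  proof
    assume ?l
    then show ?r by (auto simp: prefix_def string_code_append)
  next
    assume ?r
    then obtain u where "string_code \<tau> - string_code \<sigma> = 2 ^ length \<sigma> * u" by auto
    then have "string_code \<tau> = string_code \<sigma> + 2 ^ length \<sigma> * string_code (string_decode u)"
      using \<open>?r\<close> by simp
    then have "\<tau> = \<sigma> @ string_decode u"
      unfolding string_code_append[symmetric] string_code_eq_iff .
    then show ?l by simp
  qed
  then have "(\<lambda>x. prefix (f x) (g x)) = (\<lambda>x. string_code (f x) \<le> string_code (g x) \<and>
      (string_code (g x) - string_code (f x)) mod 2 ^ length (f x) = 0)"
    by (intro ext)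
  then show ?thesis by (rule ssubst) (intro computable_intros assms)
qed

section \<open>Semidecidable predicates\<close>

text \<open>Used to merge two successive searches into one.\<close>

lemma ex_prod_decode:
  "(\<exists>w. P (fst (prod_decode w)) (snd (prod_decode w))) \<longleftrightarrow> (\<exists>x y. P x y)"
proof
  assume "\<exists>x y. P x y"
  then obtain x y where "P x y" by blast
  then have "P (fst (prod_decode (prod_encode (x, y)))) (snd (prod_decode (prod_encode (x, y))))" by simp
  then show "\<exists>w. P (fst (prod_decode w)) (snd (prod_decode w))" by (rule exI)
qed blast

text \<open>Projections of decidable relations, in place of ranges of computable functions: the
  empty set is no special case, and closure under existential quantifiers and connectives is a
  manipulation of witnesses.\<close>

definition semidecidable :: "(nat \<Rightarrow> bool) \<Rightarrow> bool" where
  "semidecidable P \<longleftrightarrow> (\<exists>Q. decidable Q \<and> (\<forall>x. P x \<longleftrightarrow> (\<exists>y. Q (prod_encode (x, y)))))"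

lemma semidecidableI:
  assumes "decidable (\<lambda>z. Q (fst (prod_decode z)) (snd (prod_decode z)))"
    and "\<And>x. P x \<longleftrightarrow> (\<exists>y. Q x y)"
  shows "semidecidable P"
  unfolding semidecidable_def by (rule exI, rule conjI, rule assms(1)) (simp add: assms(2))

named_theorems semidecidable_intros

lemma semidecidable_decidable: "decidable P \<Longrightarrow> semidecidable P"
  by (rule semidecidableI[of "\<lambda>x y. P x"])
    (rule decidable_comp, assumption, intro computable_intros, simp)

lemma semidecidable_comp:
  assumes "semidecidable P" "computable f"
  shows "semidecidable (\<lambda>x. P (f x))"
proof -
  obtain Q where Q: "decidable Q" "\<And>x. P x \<longleftrightarrow> (\<exists>y. Q (prod_encode (x, y)))"
    using assms(1) unfolding semidecidable_def by blast
  show ?thesis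
    by (rule semidecidableI[of "\<lambda>x y. Q (prod_encode (f x, y))"])
      (auto simp: Q(2) intro!: decidable_comp[OF Q(1)] computable_intros computable_comp[OF assms(2)])
qed

lemma semidecidable_ex [semidecidable_intros]:
  assumes "semidecidable (\<lambda>z. P (fst (prod_decode z)) (snd (prod_decode z)))"
  shows "semidecidable (\<lambda>x. \<exists>y. P x y)"
proof -
  obtain Q where Q: "decidable Q"
    "\<And>z. P (fst (prod_decode z)) (snd (prod_decode z)) \<longleftrightarrow> (\<exists>y. Q (prod_encode (z, y)))"
    using assms unfolding semidecidable_def by blast
  have P: "P x y \<longleftrightarrow> (\<exists>w. Q (prod_encode (prod_encode (x, y), w)))" for x y
    using Q(2)[of "prod_encode (x, y)"] by simp
  show ?thesis
  proof (rule semidecidableI)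
    show "decidable (\<lambda>z. Q (prod_encode (prod_encode (fst (prod_decode z),
      fst (prod_decode (snd (prod_decode z)))), snd (prod_decode (snd (prod_decode z))))))"
      by (intro decidable_comp[OF Q(1)] computable_intros)
    show "(\<exists>y. P x y) \<longleftrightarrow> (\<exists>y. Q (prod_encode (prod_encode (x, fst (prod_decode y)), snd (prod_decode y))))" for x
      unfolding P ex_prod_decode[of "\<lambda>u v. Q (prod_encode (prod_encode (x, u), v))"] ..
  qed
qed

lemma semidecidable_ex_string [semidecidable_intros]:
  assumes "semidecidable (\<lambda>z. P (fst (prod_decode z)) (string_decode (snd (prod_decode z))))"
  shows "semidecidable (\<lambda>x. \<exists>\<sigma>. P x \<sigma>)"
  unfolding ex_string_decode using assms by (rule semidecidable_ex)

lemma semidecidable_conj [semidecidable_intros]: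
  assumes "semidecidable P" "semidecidable Q"
  shows "semidecidable (\<lambda>x. P x \<and> Q x)"
proof -
  obtain P' where P: "decidable P'" "\<And>x. P x \<longleftrightarrow> (\<exists>y. P' (prod_encode (x, y)))"
    using assms(1) unfolding semidecidable_def by blast
  obtain Q' where Q: "decidable Q'" "\<And>x. Q x \<longleftrightarrow> (\<exists>y. Q' (prod_encode (x, y)))"
    using assms(2) unfolding semidecidable_def by blast
  show ?thesis
  proof (rule semidecidableI)
    show "decidable (\<lambda>z. P' (prod_encode (fst (prod_decode z), fst (prod_decode (snd (prod_decode z)))))
      \<and> Q' (prod_encode (fst (prod_decode z), snd (prod_decode (snd (prod_decode z))))))"
      by (intro decidable_conj decidable_comp[OF Q(1)] decidable_comp[OF P(1)] computable_intros)
    show "P x \<and> Q x \<longleftrightarrow> (\<exists>y. P' (prod_encode (x, fst (prod_decode y))) \<and>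
      Q' (prod_encode (x, snd (prod_decode y))))" for x
      unfolding P Q ex_prod_decode[of "\<lambda>u v. P' (prod_encode (x, u)) \<and> Q' (prod_encode (x, v))"] by blast
  qed
qed

lemma semidecidable_disj [semidecidable_intros]:
  assumes "semidecidable P" "semidecidable Q"
  shows "semidecidable (\<lambda>x. P x \<or> Q x)"
proof -
  obtain P' where P: "decidable P'" "\<And>x. P x \<longleftrightarrow> (\<exists>y. P' (prod_encode (x, y)))"
    using assms(1) unfolding semidecidable_def by blast
  obtain Q' where Q: "decidable Q'" "\<And>x. Q x \<longleftrightarrow> (\<exists>y. Q' (prod_encode (x, y)))"
    using assms(2) unfolding semidecidable_def by blast
  show ?thesis
  proof (rule semidecidableI)
    show "decidable (\<lambda>z. \<not> (\<not> P' (prod_encode (fst (prod_decode z), snd (prod_decode z))) \<and>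
      \<not> Q' (prod_encode (fst (prod_decode z), snd (prod_decode z)))))"
      by (intro decidable_conj decidable_not decidable_comp[OF Q(1)] decidable_comp[OF P(1)] computable_intros)
    show "P x \<or> Q x \<longleftrightarrow> (\<exists>y. \<not> (\<not> P' (prod_encode (x, y)) \<and> \<not> Q' (prod_encode (x, y))))" for x
      unfolding P Q by blast
  qed
qed

text \<open>Effective uniformization: a value and a witness confirming it are searched for together,
  as one coded number. The hypothesis \<open>ex\<close> makes this search total.\<close>

lemma semidecidable_choice:
  assumes R: "semidecidable (\<lambda>z. R (fst (prod_decode z)) (snd (prod_decode z)))"
    and ex: "\<And>x. \<exists>y. R x y"
  obtains f where "computable f" "\<And>x. R x (f x)"
proof -
  obtain Q where Q: "decidable Q"
    "\<And>z. R (fst (prod_decode z)) (snd (prod_decode z)) \<longleftrightarrow> (\<exists>y. Q (prod_encode (z, y)))"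
    using R unfolding semidecidable_def by blast
  let ?Q = "\<lambda>x w. Q (prod_encode (prod_encode (x, fst (prod_decode w)), snd (prod_decode w)))"
  have R': "R x y \<longleftrightarrow> (\<exists>w. Q (prod_encode (prod_encode (x, y), w)))" for x y
    using Q(2)[of "prod_encode (x, y)"] by simp
  have ex': "\<exists>w. ?Q x w" for x
    using ex[of x] unfolding R' ex_prod_decode[of "\<lambda>u v. Q (prod_encode (prod_encode (x, u), v))"] .
  define f where "f x = fst (prod_decode (LEAST w. ?Q x w))" for x
  have "computable f"
    unfolding f_def by (intro computable_intros computable_Least ex' decidable_comp[OF Q(1)])
  moreover have "R x (f x)" for x
    unfolding R' f_def using LeastI_ex[OF ex'[of x]] by blast
  ultimately show thesis by (rule that)
qed

lemma semidecidable_choice_string: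
  assumes R: "semidecidable (\<lambda>z. R (fst (prod_decode z)) (string_decode (snd (prod_decode z))))"
    and ex: "\<And>x. \<exists>\<sigma>. R x \<sigma>"
  obtains f where "computable_strings f" "\<And>x. R x (f x)"
proof -
  have "\<exists>y. R x (string_decode y)" for x using ex unfolding ex_string_decode .
  from semidecidable_choice[OF R this] obtain f where "computable f" "\<And>x. R x (string_decode (f x))"
    by blast
  then show thesis by (intro that[of "\<lambda>x. string_decode (f x)"]) (simp_all add: computable_strings_def)
qed

section \<open>Enumerable sets and uniformly enumerable families of pairs\<close>

lemma ce_iff_semidecidable: "ce A \<longleftrightarrow> semidecidable (\<lambda>x. x \<in> A)"
proof
  assume "ce A"
  then consider "A = {}" | f where "computable f" "A = range f" unfolding ce_def by blast
  then show "semidecidable (\<lambda>x. x \<in> A)"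
  proof cases
    case 1
    show ?thesis unfolding 1
      by (rule semidecidable_decidable) (simp add: decidable_def computable_const)
  next
    case 2
    show ?thesis
    proof (rule semidecidableI)
      show "decidable (\<lambda>z. f (snd (prod_decode z)) = fst (prod_decode z))"
        by (intro computable_intros computable_comp[OF 2(1)])
    qed (use 2 in auto)
  qed
next
  assume "semidecidable (\<lambda>x. x \<in> A)"
  then obtain Q where Q: "decidable Q" "\<And>x. x \<in> A \<longleftrightarrow> (\<exists>y. Q (prod_encode (x, y)))"
    unfolding semidecidable_def by blast
  show "ce A"
  proof (cases "A = {}")
    case False
    then obtain a where a: "a \<in> A" by blast
    \<comment> \<open>A number that is not a confirmed pair of element and witness is sent to the
      default member \<open>a\<close>, so \<open>?f\<close> is total and stays within
      \<open>A\<close>.\<close>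
    let ?f = "\<lambda>w. if Q w then fst (prod_decode w) else a"
    have "computable ?f" by (intro computable_intros Q(1))
    moreover have "?f w \<in> A" for w
      using a Q(2)[of "fst (prod_decode w)"] by (auto intro: exI[of _ "snd (prod_decode w)"])
    moreover have "x \<in> range ?f" if "x \<in> A" for x
    proof -
      obtain y where "Q (prod_encode (x, y))" using Q(2) \<open>x \<in> A\<close> by blast
      then have "x = ?f (prod_encode (x, y))" by simp
      then show ?thesis by (rule range_eqI)
    qed
    ultimately have "A = range ?f" by blast
    with \<open>computable ?f\<close> show ?thesis unfolding ce_def by blast
  qed (simp add: ce_def)
qed

text \<open>All codings involved are bijections onto the naturals, so every number decodes to an
  index and a pair of strings. Membership becomes a condition on these parts, to which the closure
  rules apply.\<close>

lemma uniformly_ce_iff: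
  "uniformly_ce N \<longleftrightarrow> semidecidable (\<lambda>z. (string_decode (fst (prod_decode (snd (prod_decode z)))),
     string_decode (snd (prod_decode (snd (prod_decode z))))) \<in> N (fst (prod_decode z)))"
proof -
  have "z \<in> {prod_encode (k, pair_code p) |k p. p \<in> N k} \<longleftrightarrow>
    (string_decode (fst (prod_decode (snd (prod_decode z)))),
     string_decode (snd (prod_decode (snd (prod_decode z))))) \<in> N (fst (prod_decode z))" (is "?l \<longleftrightarrow> ?r") for z
  proof
    assume ?r
    moreover have "z = prod_encode (fst (prod_decode z), pair_code (string_decode (fst (prod_decode (snd (prod_decode z)))),
     string_decode (snd (prod_decode (snd (prod_decode z))))))"
      by (simp add: pair_code_def)
    ultimately show ?l unfolding mem_Collect_eq by (intro exI conjI)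
  qed (auto simp: pair_code_def)
  then show ?thesis unfolding uniformly_ce_def ce_iff_semidecidable by simp
qed

lemma uniformly_ceI:
  assumes "semidecidable (\<lambda>z. P (fst (prod_decode z)) (string_decode (fst (prod_decode (snd (prod_decode z)))))
     (string_decode (snd (prod_decode (snd (prod_decode z))))))"
  shows "uniformly_ce (\<lambda>k. {(\<pi>, \<sigma>). P k \<pi> \<sigma>})"
  using assms unfolding uniformly_ce_iff by simp

lemma semidecidable_uniformly_ce:
  assumes "uniformly_ce N" "computable e" "computable (\<lambda>x. string_code (f x))" "computable (\<lambda>x. string_code (g x))"
  shows "semidecidable (\<lambda>x. (f x, g x) \<in> N (e x))"
proof -
  have "computable (\<lambda>x. prod_encode (e x, prod_encode (string_code (f x), string_code (g x))))"
    by (intro computable_intros assms)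
  from semidecidable_comp[OF assms(1)[unfolded uniformly_ce_iff] this] show ?thesis by simp
qed

text \<open>Treating a single machine as a constant family makes one set of rules serve
  both.\<close>

lemma ce_pairs_iff_uniformly_ce: "ce_pairs M \<longleftrightarrow> uniformly_ce (\<lambda>_. M)"
proof -
  have "z \<in> pair_code ` M \<longleftrightarrow>
    (string_decode (fst (prod_decode z)), string_decode (snd (prod_decode z))) \<in> M" for z
    by (force simp: pair_code_def image_iff)
  then have *: "ce_pairs M \<longleftrightarrow> semidecidable (\<lambda>z.
     (string_decode (fst (prod_decode z)), string_decode (snd (prod_decode z))) \<in> M)"
    unfolding ce_pairs_def ce_iff_semidecidable by simp
  show ?thesis
  proof
    assume "ce_pairs M"
    from semidecidable_comp[OF this[unfolded *], of "\<lambda>z. snd (prod_decode z)"]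
    show "uniformly_ce (\<lambda>_. M)" unfolding uniformly_ce_iff by (simp add: computable_intros)
  next
    assume "uniformly_ce (\<lambda>_. M)"
    then show "ce_pairs M"
      unfolding * by (rule semidecidable_uniformly_ce[where e = "\<lambda>_. 0"]) (intro computable_intros)+
  qed
qed

section \<open>Computable reals\<close>

text \<open>Computable sequences of nonnegative reals.  The error bound carries an arbitrary computable
  factor \<open>c n\<close>, so that approximations of sums are simply sums of approximations.\<close>

definition effective :: "(nat \<Rightarrow> real) \<Rightarrow> bool" where
  "effective x \<longleftrightarrow> (\<exists>a c. computable a \<and> computable c \<and>
     (\<forall>n k. \<bar>x n - real (a (prod_encode (n, k))) / 2 ^ k\<bar> \<le> real (c n) / 2 ^ k))"

lemma effectiveI:
  assumes "computable (\<lambda>z. a (fst (prod_decode z)) (snd (prod_decode z)))" "computable c"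
    and "\<And>n k. \<bar>x n - real (a n k) / 2 ^ k\<bar> \<le> real (c n) / 2 ^ k"
  shows "effective x"
  unfolding effective_def by (rule exI, rule exI, rule conjI, rule assms(1), rule conjI, rule assms(2))
    (simp add: assms(3))

lemma effectiveE:
  assumes "effective x"
  obtains a c where "computable (\<lambda>z. a (fst (prod_decode z)) (snd (prod_decode z)))" "computable c"
    "\<And>n k. \<bar>x n - real (a n k) / 2 ^ k\<bar> \<le> real (c n) / 2 ^ k"
proof -
  obtain a c where "computable a" "computable c"
    "\<And>n k. \<bar>x n - real (a (prod_encode (n, k))) / 2 ^ k\<bar> \<le> real (c n) / 2 ^ k"
    using assms unfolding effective_def by blast
  then show thesis by (intro that[of "\<lambda>n k. a (prod_encode (n, k))" c]) simp_all
qed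

lemma computable_comp_pair:
  assumes "computable (\<lambda>z. a (fst (prod_decode z)) (snd (prod_decode z)))" "computable f" "computable g"
  shows "computable (\<lambda>x. a (f x) (g x))"
  using computable_comp[OF assms(1) computable_prod_encode[OF assms(2,3)]] by simp

lemma effective_comp:
  assumes "effective x" "computable f" shows "effective (\<lambda>n. x (f n))"
proof -
  obtain a c where a: "computable (\<lambda>z. a (fst (prod_decode z)) (snd (prod_decode z)))" "computable c"
    "\<And>n k. \<bar>x n - real (a n k) / 2 ^ k\<bar> \<le> real (c n) / 2 ^ k"
    by (rule effectiveE[OF assms(1)]) (rule that)
  show ?thesis
    by (rule effectiveI[of "\<lambda>n k. a (f n) k" "\<lambda>n. c (f n)"])
      (intro computable_intros computable_comp_pair[OF a(1)] computable_comp[OF a(2)] computable_comp[OF assms(2)] assms(2) a(3))+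
qed

lemma effective_add:
  assumes "effective x" "effective y" shows "effective (\<lambda>n. x n + y n)"
proof -
  obtain a c where a: "computable (\<lambda>z. a (fst (prod_decode z)) (snd (prod_decode z)))" "computable c"
    "\<And>n k. \<bar>x n - real (a n k) / 2 ^ k\<bar> \<le> real (c n) / 2 ^ k"
    by (rule effectiveE[OF assms(1)]) (rule that)
  obtain b d where b: "computable (\<lambda>z. b (fst (prod_decode z)) (snd (prod_decode z)))" "computable d"
    "\<And>n k. \<bar>y n - real (b n k) / 2 ^ k\<bar> \<le> real (d n) / 2 ^ k"
    by (rule effectiveE[OF assms(2)]) (rule that)
  show ?thesis
  proof (rule effectiveI)
    show "computable (\<lambda>z. a (fst (prod_decode z)) (snd (prod_decode z)) + b (fst (prod_decode z)) (snd (prod_decode z)))"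
      "computable (\<lambda>n. c n + d n)"
      by (intro computable_intros a b)+
    show "\<bar>x n + y n - real (a n k + b n k) / 2 ^ k\<bar> \<le> real (c n + d n) / 2 ^ k" for n k
      using a(3)[of n k] b(3)[of n k] unfolding of_nat_add add_divide_distrib by linarith
  qed
qed

lemma effective_sum:
  assumes "effective (\<lambda>z. x (fst (prod_decode z)) (snd (prod_decode z)))" "computable m"
  shows "effective (\<lambda>n. \<Sum>i<m n. x n i)"
proof -
  obtain a c where a: "computable (\<lambda>z. a (fst (prod_decode z)) (snd (prod_decode z)))" "computable c"
    "\<And>n k. \<bar>x (fst (prod_decode n)) (snd (prod_decode n)) - real (a n k) / 2 ^ k\<bar> \<le> real (c n) / 2 ^ k"
    by (rule effectiveE[OF assms(1)]) (rule that)
  have le: "\<bar>x n i - real (a (prod_encode (n, i)) k) / 2 ^ k\<bar> \<le> real (c (prod_encode (n, i))) / 2 ^ k" for n i k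
    using a(3)[of "prod_encode (n, i)" k] by simp
  show ?thesis
  proof (rule effectiveI)
    show "computable (\<lambda>z. \<Sum>i<m (fst (prod_decode z)). a (prod_encode (fst (prod_decode z), i)) (snd (prod_decode z)))"
      "computable (\<lambda>n. \<Sum>i<m n. c (prod_encode (n, i)))"
      by (intro computable_intros computable_comp_pair[OF a(1)] computable_comp[OF a(2)] computable_comp[OF assms(2)] assms(2))+
    fix n k
    have "\<bar>(\<Sum>i<m n. x n i) - real (\<Sum>i<m n. a (prod_encode (n, i)) k) / 2 ^ k\<bar>
      = \<bar>\<Sum>i<m n. x n i - real (a (prod_encode (n, i)) k) / 2 ^ k\<bar>"
      by (simp add: sum_subtractf sum_divide_distrib)
    also have "\<dots> \<le> (\<Sum>i<m n. \<bar>x n i - real (a (prod_encode (n, i)) k) / 2 ^ k\<bar>)" by (rule sum_abs)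
    also have "\<dots> \<le> (\<Sum>i<m n. real (c (prod_encode (n, i))) / 2 ^ k)" by (intro sum_mono le)
    finally show "\<bar>(\<Sum>i<m n. x n i) - real (\<Sum>i<m n. a (prod_encode (n, i)) k) / 2 ^ k\<bar>
      \<le> real (\<Sum>i<m n. c (prod_encode (n, i))) / 2 ^ k"
      by (simp add: sum_divide_distrib)
  qed
qed

lemma effective_if:
  assumes "decidable P" "effective x"
  shows "effective (\<lambda>n. if P n then x n else 0)"
proof -
  obtain a c where a: "computable (\<lambda>z. a (fst (prod_decode z)) (snd (prod_decode z)))" "computable c"
    "\<And>n k. \<bar>x n - real (a n k) / 2 ^ k\<bar> \<le> real (c n) / 2 ^ k"
    by (rule effectiveE[OF assms(2)]) (rule that)
  show ?thesis
  proof (rule effectiveI)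
    show "computable (\<lambda>z. if P (fst (prod_decode z)) then a (fst (prod_decode z)) (snd (prod_decode z)) else 0)"
      by (intro computable_intros a decidable_comp[OF assms(1)])
    show "computable c" by (rule a)
  qed (use a(3) in auto)
qed

text \<open>At precision \<open>k\<close>, strictness is confirmed once the approximations differ by
  more than their combined error. If \<open>x n < y n\<close>, the scaled difference grows like
  \<open>2 ^ k\<close> while the error bounds stay fixed, so some \<open>k\<close> succeeds.\<close>

lemma semidecidable_effective_less:
  assumes "effective x" "effective y" shows "semidecidable (\<lambda>n. x n < y n)"
proof -
  obtain a c where a: "computable (\<lambda>z. a (fst (prod_decode z)) (snd (prod_decode z)))" "computable c"
    "\<And>n k. \<bar>x n - real (a n k) / 2 ^ k\<bar> \<le> real (c n) / 2 ^ k"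
    by (rule effectiveE[OF assms(1)]) (rule that)
  obtain b d where b: "computable (\<lambda>z. b (fst (prod_decode z)) (snd (prod_decode z)))" "computable d"
    "\<And>n k. \<bar>y n - real (b n k) / 2 ^ k\<bar> \<le> real (d n) / 2 ^ k"
    by (rule effectiveE[OF assms(2)]) (rule that)
  show ?thesis
  proof (rule semidecidableI)
    show "decidable (\<lambda>z. a (fst (prod_decode z)) (snd (prod_decode z)) + c (fst (prod_decode z)) + d (fst (prod_decode z))
      < b (fst (prod_decode z)) (snd (prod_decode z)))"
      by (intro computable_intros a b computable_comp[OF a(2)] computable_comp[OF b(2)])
    fix n
    have a': "\<bar>x n * 2 ^ k - real (a n k)\<bar> \<le> real (c n)" for k
      using a(3)[of n k] by (simp add: abs_le_iff field_simps)
    have b': "\<bar>y n * 2 ^ k - real (b n k)\<bar> \<le> real (d n)" for k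
      using b(3)[of n k] by (simp add: abs_le_iff field_simps)
    show "x n < y n \<longleftrightarrow> (\<exists>k. a n k + c n + d n < b n k)"
    proof
      assume "x n < y n"
      obtain k where "2 * real (c n + d n) / (y n - x n) < 2 ^ k"
        using real_arch_pow[of 2] by auto
      with \<open>x n < y n\<close> have "2 * real (c n + d n) < (y n - x n) * 2 ^ k"
        by (simp add: field_simps)
      with a'[of k] b'[of k] have "real (a n k + c n + d n) < real (b n k)"
        by (simp add: abs_le_iff algebra_simps)
      then show "\<exists>k. a n k + c n + d n < b n k" by (intro exI[of _ k]) linarith
    next
      assume "\<exists>k. a n k + c n + d n < b n k"
      then obtain k where "a n k + c n + d n < b n k" by blast
      then have "real (a n k) + real (c n) + real (d n) < real (b n k)" by linarith
      with a'[of k] b'[of k] have "x n * 2 ^ k < y n * 2 ^ k" by linarith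
      then show "x n < y n" by simp
    qed
  qed
qed

text \<open>Signed rationals become natural numerators over \<open>2 ^ k\<close>: rounding down
  costs at most one unit and the given approximation less than one, whence the constant 2. A
  negative approximation may be replaced by 0 because the limit is nonnegative.\<close>

lemma effective_rat_decode:
  assumes "computable f"
    and "\<And>n k. \<bar>of_rat (rat_decode (f (prod_encode (n, k)))) - x n\<bar> < (1 / 2 :: real) ^ k"
    and "\<And>n. 0 \<le> x n"
  shows "effective x"
proof -
  \<comment> \<open>\<open>int_decode\<close> sends even codes to the nonnegative integers, so the
    parity of the numerator code tells its sign.\<close>
  define a where "a n k = (let z = prod_decode (f (prod_encode (n, k))) in
    if fst z mod 2 = 0 then 2 ^ k * (fst z div 2) div Suc (snd z) else 0)" for n k
  show ?thesis
  proof (rule effectiveI)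
    show "computable (\<lambda>z. a (fst (prod_decode z)) (snd (prod_decode z)))"
      unfolding a_def Let_def by (intro computable_intros computable_comp[OF assms(1)])
    show "computable (\<lambda>_. 2)" by (rule computable_const)
    fix n k
    let ?r = "of_rat (rat_decode (f (prod_encode (n, k)))) :: real"
    obtain i b where ib: "prod_decode (f (prod_encode (n, k))) = (i, b)" by (cases "prod_decode (f (prod_encode (n, k)))")
    have r: "?r = of_int (int_decode i) / real (Suc b)"
      unfolding rat_decode_def ib by (simp add: of_rat_divide flip: of_nat_Suc)
    have near: "\<bar>?r - x n\<bar> * 2 ^ k < 1"
      using assms(2)[of n k] by (simp add: power_divide field_simps)
    have "\<bar>?r * 2 ^ k - real (a n k)\<bar> \<le> 1 \<or> (?r \<le> 0 \<and> a n k = 0)"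
    proof (cases "even i")
      case True
      then have "int_decode i = int (i div 2)"
        by (auto simp: int_decode_def sum_decode_def)
      then have "?r * 2 ^ k = real (2 ^ k * (i div 2)) / real (Suc b)"
        unfolding r by simp
      moreover have "a n k = 2 ^ k * (i div 2) div Suc b"
        using True unfolding a_def ib Let_def by (simp add: even_iff_mod_2_eq_zero)
      moreover have "\<bar>real m / real (Suc l) - real (m div Suc l)\<bar> \<le> 1" for m l
        using floor_divide_of_nat_eq[of m "Suc l", where ?'a = real] by linarith
      ultimately show ?thesis by metis
    next
      case False
      then have "int_decode i \<le> 0"
        by (auto simp: int_decode_def sum_decode_def)
      then have "?r \<le> 0" unfolding r by (simp add: divide_nonpos_pos)
      moreover have "a n k = 0"
        using False unfolding a_def ib Let_def by (simp add: odd_iff_mod_2_eq_one)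
      ultimately show ?thesis by blast
    qed
    then have "\<bar>x n * 2 ^ k - real (a n k)\<bar> \<le> 2"
    proof
      assume "\<bar>?r * 2 ^ k - real (a n k)\<bar> \<le> 1"
      moreover have "\<bar>?r * 2 ^ k - x n * 2 ^ k\<bar> < 1"
        using near by (simp add: abs_mult flip: left_diff_distrib)
      ultimately show ?thesis by linarith
    next
      assume *: "?r \<le> 0 \<and> a n k = 0"
      then have "x n \<le> \<bar>?r - x n\<bar>" by linarith
      then have "x n * 2 ^ k \<le> \<bar>?r - x n\<bar> * 2 ^ k" by (rule mult_right_mono) simp
      then have "x n * 2 ^ k < 1" using near by linarith
      moreover have "0 \<le> x n * 2 ^ k" using assms(3)[of n] by simp
      ultimately show ?thesis using * by simp
    qed
    then show "\<bar>x n - real (a n k) / 2 ^ k\<bar> \<le> real 2 / 2 ^ k"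
      by (simp add: abs_le_iff field_simps)
  qed
qed

section \<open>Cylinder measures as computable reals\<close>

lemma computable_measure_effective:
  assumes "computable_measure \<mu>"
  shows "effective (\<lambda>n. measure \<mu> (cylinder (string_decode n)))"
proof -
  obtain g f where g: "\<And>\<sigma> k. \<bar>of_rat (g \<sigma> k) - measure \<mu> (cylinder \<sigma>)\<bar> < (1 / 2 :: real) ^ k"
    and f: "computable f" "\<And>\<sigma> k. g \<sigma> k = rat_decode (f (prod_encode (string_code \<sigma>, k)))"
    using assms unfolding computable_measure_def computable_rats_def by blast
  show ?thesis
    by (rule effective_rat_decode[OF f(1)]) (use g[of "string_decode _", unfolded f(2)] in auto)
qed

lemma computable_measure_fair_coin: "computable_measure fair_coin_measure"
proof -
  \<comment> \<open>Code 2 stands for the integer 1, and the subtraction of 1 compensates for the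
    \<open>Suc\<close> in the denominator of \<open>rat_decode\<close>.\<close>
  let ?f = "\<lambda>z. prod_encode (2, 2 ^ length (string_decode (fst (prod_decode z))) - 1)"
  have dec: "rat_decode (?f (prod_encode (string_code \<sigma>, k))) = (1 / 2) ^ length \<sigma>" for \<sigma> k
  proof -
    have "int_decode 2 = 1" by (simp add: int_decode_def sum_decode_def)
    then show ?thesis
      unfolding rat_decode_def by (simp add: power_divide of_nat_diff)
  qed
  have "computable ?f" by (intro computable_intros)
  then have "computable_rats (\<lambda>\<sigma> k. (1 / 2) ^ length \<sigma>)"
    unfolding computable_rats_def by (intro exI[of _ ?f] conjI allI dec[symmetric])
  moreover have "\<bar>of_rat ((1 / 2) ^ length \<sigma>) - measure fair_coin_measure (cylinder \<sigma>)\<bar> < (1 / 2 :: real) ^ k" for \<sigma> k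
    by (simp add: fair_coin_measure_cylinder of_rat_power of_rat_divide)
  ultimately show ?thesis
    unfolding computable_measure_def
    by (intro conjI prob_space_fair_coin_measure sets_fair_coin_measure exI) (assumption, blast)
qed

section \<open>Atomless measures and the unit interval\<close>

lemma cylinder_Nil [simp]: "cylinder [] = UNIV"
  by (simp add: cylinder_def)

lemma mem_cylinder_iff: "X \<in> cylinder \<sigma> \<longleftrightarrow> \<sigma> = map X [0..<length \<sigma>]"
proof -
  have "\<sigma> = map X [0..<length \<sigma>] \<longleftrightarrow> (\<forall>i<length \<sigma>. \<sigma> ! i = X i)"
    unfolding list_eq_iff_nth_eq by simp
  then show ?thesis unfolding cylinder_def mem_Collect_eq by (simp only: eq_commute)
qed

lemma mem_cylinder_map_upt [simp]: "X \<in> cylinder (map X [0..<n])"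
  by (simp add: mem_cylinder_iff)

lemma cylinder_append_subset: "cylinder (\<sigma> @ \<tau>) \<subseteq> cylinder \<sigma>"
proof
  fix X assume X: "X \<in> cylinder (\<sigma> @ \<tau>)"
  have "X i = \<sigma> ! i" if "i < length \<sigma>" for i
    using X that by (simp add: cylinder_def nth_append_left)
  then show "X \<in> cylinder \<sigma>" by (simp add: cylinder_def)
qed

lemma cylinder_mono: "prefix \<sigma> \<tau> \<Longrightarrow> cylinder \<tau> \<subseteq> cylinder \<sigma>"
  using cylinder_append_subset by (auto simp: prefix_def)

lemma prefix_map_upt: "m \<le> n \<Longrightarrow> prefix (map X [0..<m]) (map X [0..<n])"
  using upt_add_eq_append[of 0 m "n - m"] by (simp add: prefix_def)

lemma comparable_cylinder:
  assumes "X \<in> cylinder \<sigma>" "X \<in> cylinder \<tau>" shows "comparable \<sigma> \<tau>"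
  using prefix_map_upt[of "length \<sigma>" "length \<tau>" X] prefix_map_upt[of "length \<tau>" "length \<sigma>" X]
  unfolding comparable_def assms[unfolded mem_cylinder_iff, symmetric] by linarith

lemma mem_cylinder_snoc: "X \<in> cylinder (\<sigma> @ [b]) \<longleftrightarrow> X \<in> cylinder \<sigma> \<and> X (length \<sigma>) = b"
  unfolding mem_cylinder_iff by auto

lemma cylinder_snoc: "cylinder \<sigma> = cylinder (\<sigma> @ [False]) \<union> cylinder (\<sigma> @ [True])"
  using mem_cylinder_snoc by blast

lemma disjoint_cylinder_snoc: "cylinder (\<sigma> @ [False]) \<inter> cylinder (\<sigma> @ [True]) = {}"
  by (auto simp: mem_cylinder_snoc)

lemma open_cylinder: "open (cylinder \<sigma>)"
proof -
  have "cylinder \<sigma> = (\<Inter>i<length \<sigma>. (\<lambda>X. X i) -` {\<sigma> ! i})"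
    by (auto simp: cylinder_def)
  moreover have "open ((\<lambda>X::nat \<Rightarrow> bool. X i) -` {b})" for i b
    by (intro open_vimage discrete_topology_class.open_discrete continuous_on_product_coordinates)
  ultimately show ?thesis by (simp add: open_INT)
qed

lemma open_cylinders: "open (cylinders A)"
  unfolding cylinders_def by (intro open_UN ballI open_cylinder)

section \<open>The interval of a string\<close>

text \<open>Each \<tau> in the sum is a prefix at which \<sigma> turns right, so the sum is the mass
  lying lexicographically before the cylinder of \<sigma>.\<close>

definition left_end :: "(nat \<Rightarrow> bool) measure \<Rightarrow> bool list \<Rightarrow> real" where
  "left_end \<mu> \<sigma> = (\<Sum>\<tau> | prefix (\<tau> @ [True]) \<sigma>. measure \<mu> (cylinder (\<tau> @ [False])))"

definition right_end :: "(nat \<Rightarrow> bool) measure \<Rightarrow> bool list \<Rightarrow> real" where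
  "right_end \<mu> \<sigma> = left_end \<mu> \<sigma> + measure \<mu> (cylinder \<sigma>)"

lemma left_end_Nil [simp]: "left_end \<mu> [] = 0"
  by (simp add: left_end_def)

lemma left_end_snoc:
  "left_end \<mu> (\<sigma> @ [b]) = left_end \<mu> \<sigma> + (if b then measure \<mu> (cylinder (\<sigma> @ [False])) else 0)"
proof -
  have fin: "finite {\<tau>. prefix (\<tau> @ [True]) \<sigma>}"
    by (rule finite_subset[of _ "set (prefixes \<sigma>)"]) (auto simp: prefix_def)
  have "{\<tau>. prefix (\<tau> @ [True]) (\<sigma> @ [b])} = (if b then insert \<sigma> else id) {\<tau>. prefix (\<tau> @ [True]) \<sigma>}"
    by (cases b) auto
  moreover have "\<not> prefix (\<sigma> @ [True]) \<sigma>" by (auto simp: prefix_def)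
  ultimately show ?thesis unfolding left_end_def using fin by simp
qed

text \<open>The intervals from \<^const>\<open>left_end\<close> to \<^const>\<open>right_end\<close> of the strings of a fixed
  length partition the unit interval in lexicographic order, and prefixes correspond to inclusion;
  \<open>cdf_map\<close> sends a sequence to the point in the intersection of the intervals of its prefixes.\<close>

definition cdf_map :: "(nat \<Rightarrow> bool) measure \<Rightarrow> (nat \<Rightarrow> bool) \<Rightarrow> real" where
  "cdf_map \<mu> X = (SUP n. left_end \<mu> (map X [0..<n]))"

text \<open>Requiring a nondegenerate \<open>\<nu>\<close>-interval restricts transported machines to strings of positive
  \<open>\<nu>\<close>-measure, which is what makes the new universal machine compatible with \<open>\<nu>\<close>.\<close>

definition fits_in ::
  "(nat \<Rightarrow> bool) measure \<Rightarrow> bool list \<Rightarrow> (nat \<Rightarrow> bool) measure \<Rightarrow> bool list \<Rightarrow> bool" where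
  "fits_in \<mu> \<rho> \<nu> \<pi> \<longleftrightarrow> left_end \<mu> \<rho> < left_end \<nu> \<pi> \<and> left_end \<nu> \<pi> < right_end \<nu> \<pi> \<and>
     right_end \<nu> \<pi> < right_end \<mu> \<rho>"

definition transport ::
  "(nat \<Rightarrow> bool) measure \<Rightarrow> (nat \<Rightarrow> bool) measure \<Rightarrow> bool list set \<Rightarrow> bool list set" where
  "transport \<mu> \<nu> A = {\<pi>. \<exists>\<rho>\<in>A. fits_in \<mu> \<rho> \<nu> \<pi>}"

locale cantor_measure = prob_space \<mu> for \<mu> :: "(nat \<Rightarrow> bool) measure" +
  assumes sets_eq [simp, measurable_cong]: "sets \<mu> = sets borel"
begin

lemma space_eq [simp]: "space \<mu> = UNIV"
  using sets_eq_imp_space_eq[OF sets_eq] by simp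

lemma sets_cylinder [measurable]: "cylinder \<sigma> \<in> sets \<mu>"
  using open_cylinder by simp

lemma sets_cylinders [measurable]: "cylinders A \<in> sets \<mu>"
  using open_cylinders by simp

lemma measure_snoc:
  "measure \<mu> (cylinder \<sigma>) = measure \<mu> (cylinder (\<sigma> @ [False])) + measure \<mu> (cylinder (\<sigma> @ [True]))"
  unfolding cylinder_snoc[of \<sigma>]
  by (rule finite_measure_Union) (simp_all add: disjoint_cylinder_snoc sets_cylinder del: sets_eq)

lemma left_end_le_right_end: "left_end \<mu> \<sigma> \<le> right_end \<mu> \<sigma>"
  by (simp add: right_end_def)

lemma right_end_Nil [simp]: "right_end \<mu> [] = 1"
  using prob_space by (simp add: right_end_def)

lemma ends_snoc:
  "left_end \<mu> (\<sigma> @ [False]) = left_end \<mu> \<sigma>"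
  "right_end \<mu> (\<sigma> @ [False]) = left_end \<mu> (\<sigma> @ [True])"
  "right_end \<mu> (\<sigma> @ [True]) = right_end \<mu> \<sigma>"
  using measure_snoc[of \<sigma>] by (simp_all add: right_end_def left_end_snoc)

lemma ends_mono:
  assumes "prefix \<sigma> \<tau>"
  shows "left_end \<mu> \<sigma> \<le> left_end \<mu> \<tau>" "right_end \<mu> \<tau> \<le> right_end \<mu> \<sigma>"
proof -
  obtain \<upsilon> where "\<tau> = \<sigma> @ \<upsilon>" using assms by (auto simp: prefix_def)
  moreover have "left_end \<mu> \<sigma> \<le> left_end \<mu> (\<sigma> @ \<upsilon>) \<and> right_end \<mu> (\<sigma> @ \<upsilon>) \<le> right_end \<mu> \<sigma>"
  proof (induction \<upsilon> rule: rev_induct)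
    case (snoc b \<upsilon>)
    then show ?case
      using ends_snoc[of "\<sigma> @ \<upsilon>"] left_end_le_right_end[of "\<sigma> @ \<upsilon> @ [False]"]
        left_end_le_right_end[of "\<sigma> @ \<upsilon> @ [True]"]
      by (cases b) auto
  qed simp
  ultimately show "left_end \<mu> \<sigma> \<le> left_end \<mu> \<tau>" "right_end \<mu> \<tau> \<le> right_end \<mu> \<sigma>" by auto
qed

text \<open>Where the strings first differ they pass through two siblings, whose intervals abut; the
  remaining bits only shrink the intervals.\<close>

lemma ends_incomparable:
  assumes "\<not> comparable \<sigma> \<tau>"
  shows "right_end \<mu> \<sigma> \<le> left_end \<mu> \<tau> \<or> right_end \<mu> \<tau> \<le> left_end \<mu> \<sigma>"
proof -
  from assms have par: "\<sigma> \<parallel> \<tau>" unfolding comparable_def parallel_def by simp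
  obtain \<alpha> b \<beta> c \<gamma> where *: "b \<noteq> c" "\<sigma> = \<alpha> @ b # \<beta>" "\<tau> = \<alpha> @ c # \<gamma>"
    using parallel_decomp[OF par] by (elim exE conjE) (rule that)
  have "prefix (\<alpha> @ [b]) \<sigma>" "prefix (\<alpha> @ [c]) \<tau>" unfolding *(2,3) by simp_all
  note m = ends_mono[OF this(1)] ends_mono[OF this(2)]
  show ?thesis
    using m ends_snoc[of \<alpha>] \<open>b \<noteq> c\<close> by (cases b; cases c) auto
qed

text \<open>Intervals of incomparable strings can meet only in end points, which an interior point
  of one of them excludes.\<close>

lemma comparable_of_overlap:
  "left_end \<mu> \<sigma> < x \<Longrightarrow> x < right_end \<mu> \<sigma> \<Longrightarrow> left_end \<mu> \<tau> \<le> x \<Longrightarrow> x \<le> right_end \<mu> \<tau> \<Longrightarrow> comparable \<sigma> \<tau>"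
  using ends_incomparable[of \<sigma> \<tau>] by force

lemma cdf_map_bounds:
  "left_end \<mu> (map X [0..<n]) \<le> cdf_map \<mu> X" "cdf_map \<mu> X \<le> right_end \<mu> (map X [0..<n])"
proof -
  \<comment> \<open>Of two prefixes of \<open>X\<close>, the longer has its interval inside that of
    the shorter; hence no left end exceeds any right end.\<close>
  have *: "left_end \<mu> (map X [0..<m]) \<le> right_end \<mu> (map X [0..<k])" for m k
    using ends_mono[OF prefix_map_upt[of m k X]] ends_mono[OF prefix_map_upt[of k m X]]
      left_end_le_right_end[of "map X [0..<m]"] left_end_le_right_end[of "map X [0..<k]"]
    by (cases "m \<le> k") auto
  then have "bdd_above (range (\<lambda>n. left_end \<mu> (map X [0..<n])))"
    by (intro bdd_aboveI2)
  then show "left_end \<mu> (map X [0..<n]) \<le> cdf_map \<mu> X"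
    unfolding cdf_map_def by (rule cSUP_upper[rotated]) simp
  show "cdf_map \<mu> X \<le> right_end \<mu> (map X [0..<n])"
    unfolding cdf_map_def by (rule cSUP_least) (simp_all add: *)
qed

lemma cdf_map_mem:
  assumes "X \<in> cylinder \<sigma>"
  shows "left_end \<mu> \<sigma> \<le> cdf_map \<mu> X" "cdf_map \<mu> X \<le> right_end \<mu> \<sigma>"
  using cdf_map_bounds[of X "length \<sigma>"] assms[unfolded mem_cylinder_iff, symmetric] by simp_all

end

section \<open>Uniform distribution of \<open>cdf_map\<close> for atomless measures\<close>

locale atomless_cantor_measure = cantor_measure +
  assumes measure_singleton: "measure \<mu> {X} = 0"
begin

text \<open>Atomlessness enters here, by continuity from above: the cylinders shrink to the
  singleton of \<open>X\<close>. It forces both ends of the intervals to a common limit.\<close>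

lemma measure_prefixes_tendsto: "(\<lambda>n. measure \<mu> (cylinder (map X [0..<n]))) \<longlonglongrightarrow> 0"
proof -
  have "(\<lambda>n. measure \<mu> (cylinder (map X [0..<n]))) \<longlonglongrightarrow> measure \<mu> (\<Inter>n. cylinder (map X [0..<n]))"
    by (rule finite_Lim_measure_decseq)
      (auto simp: decseq_def open_cylinder dest: subsetD[OF cylinder_mono[OF prefix_map_upt]])
  moreover have "(\<Inter>n. cylinder (map X [0..<n])) = {X}"
    by (auto simp: cylinder_def fun_eq_iff)
  ultimately show ?thesis by (simp add: measure_singleton)
qed

lemma ends_tendsto_cdf_map:
  "(\<lambda>n. left_end \<mu> (map X [0..<n])) \<longlonglongrightarrow> cdf_map \<mu> X"
  "(\<lambda>n. right_end \<mu> (map X [0..<n])) \<longlonglongrightarrow> cdf_map \<mu> X"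
proof -
  show 1: "(\<lambda>n. left_end \<mu> (map X [0..<n])) \<longlonglongrightarrow> cdf_map \<mu> X"
  proof (rule real_tendsto_sandwich[where h = "\<lambda>_. cdf_map \<mu> X"])
    show "(\<lambda>n. cdf_map \<mu> X - measure \<mu> (cylinder (map X [0..<n]))) \<longlonglongrightarrow> cdf_map \<mu> X"
      using tendsto_diff[OF tendsto_const measure_prefixes_tendsto] by simp
    show "\<forall>\<^sub>F n in sequentially. cdf_map \<mu> X - measure \<mu> (cylinder (map X [0..<n])) \<le> left_end \<mu> (map X [0..<n])"
      using cdf_map_bounds(2)[of X] by (simp add: right_end_def algebra_simps)
  qed (simp_all add: cdf_map_bounds)
  show "(\<lambda>n. right_end \<mu> (map X [0..<n])) \<longlonglongrightarrow> cdf_map \<mu> X"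
    using tendsto_add[OF 1 measure_prefixes_tendsto] by (simp add: right_end_def)
qed

text \<open>A pointwise limit of functions that depend on finitely many bits.\<close>

lemma measurable_cdf_map [measurable]: "cdf_map \<mu> \<in> borel_measurable \<mu>"
proof (rule borel_measurable_LIMSEQ_real[OF ends_tendsto_cdf_map(1)])
  fix n
  have "(\<lambda>X. map X [0..<n]) \<in> measurable \<mu> (count_space UNIV)"
  proof (subst measurable_count_space_eq_countable[OF countableI_type], safe)
    fix \<sigma> :: "bool list"
    have "(\<lambda>X. map X [0..<n]) -` {\<sigma>} \<inter> space \<mu> = (if length \<sigma> = n then cylinder \<sigma> else {})"
      by (auto simp: mem_cylinder_iff)
    then show "(\<lambda>X. map X [0..<n]) -` {\<sigma>} \<inter> space \<mu> \<in> sets \<mu>"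
      using sets_cylinder by simp
  qed simp
  then show "(\<lambda>X. left_end \<mu> (map X [0..<n])) \<in> borel_measurable \<mu>"
    by (rule measurable_compose) simp
qed

text \<open>The intervals of the extensions of \<sigma> by \<open>n\<close> bits do not overlap, and
  those counted lie both in the interval of \<sigma> and between \<open>a\<close> and
  \<open>b\<close>. The induction splits off the first new bit, since the overlaps with the two
  child intervals add up.\<close>

lemma sum_measure_strings_le:
  "(\<Sum>\<tau> | length \<tau> = n. if a < left_end \<mu> (\<sigma> @ \<tau>) \<and> right_end \<mu> (\<sigma> @ \<tau>) < b
      then measure \<mu> (cylinder (\<sigma> @ \<tau>)) else 0)
    \<le> max 0 (min b (right_end \<mu> \<sigma>) - max a (left_end \<mu> \<sigma>))"
proof (induction n arbitrary: \<sigma>)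
  case 0
  have "{\<tau>::bool list. length \<tau> = 0} = {[]}" by auto
  then show ?case by (simp only:) (auto simp: right_end_def)
next
  case (Suc n)
  let ?g = "\<lambda>\<sigma>. if a < left_end \<mu> \<sigma> \<and> right_end \<mu> \<sigma> < b then measure \<mu> (cylinder \<sigma>) else 0"
  let ?A = "{\<tau>::bool list. length \<tau> = n}"
  have fin: "finite ?A" using finite_lists_length_eq[of "UNIV :: bool set" n] by simp
  have "{\<tau>::bool list. length \<tau> = Suc n} = Cons False ` ?A \<union> Cons True ` ?A"
  proof (intro set_eqI iffI)
    fix \<tau> :: "bool list" assume "\<tau> \<in> {\<tau>. length \<tau> = Suc n}"
    then obtain c \<upsilon> where "\<tau> = c # \<upsilon>" "length \<upsilon> = n" by (auto simp: length_Suc_conv)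
    then show "\<tau> \<in> Cons False ` ?A \<union> Cons True ` ?A" by (cases c) auto
  qed auto
  then have "(\<Sum>\<tau> | length \<tau> = Suc n. ?g (\<sigma> @ \<tau>)) =
      (\<Sum>\<tau>\<in>Cons False ` ?A. ?g (\<sigma> @ \<tau>)) + (\<Sum>\<tau>\<in>Cons True ` ?A. ?g (\<sigma> @ \<tau>))"
    using fin by (simp only:) (rule sum.union_disjoint; auto)
  also have "\<dots> = (\<Sum>\<tau> | length \<tau> = n. ?g ((\<sigma> @ [False]) @ \<tau>)) + (\<Sum>\<tau> | length \<tau> = n. ?g ((\<sigma> @ [True]) @ \<tau>))"
    by (simp add: sum.reindex inj_on_def cong: if_cong)
  also have "\<dots> \<le> max 0 (min b (right_end \<mu> (\<sigma> @ [False])) - max a (left_end \<mu> (\<sigma> @ [False])))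
      + max 0 (min b (right_end \<mu> (\<sigma> @ [True])) - max a (left_end \<mu> (\<sigma> @ [True])))"
    by (intro add_mono Suc.IH)
  also have "\<dots> \<le> max 0 (min b (right_end \<mu> \<sigma>) - max a (left_end \<mu> \<sigma>))"
    using ends_snoc[of \<sigma>] left_end_le_right_end[of "\<sigma> @ [False]"] left_end_le_right_end[of "\<sigma> @ [True]"]
    by (auto simp: max_def min_def)
  finally show ?case .
qed

lemma cdf_map_nested:
  assumes "a < cdf_map \<mu> X" "cdf_map \<mu> X < b"
  obtains n where "a < left_end \<mu> (map X [0..<n])" "right_end \<mu> (map X [0..<n]) < b"
proof -
  have "\<forall>\<^sub>F n in sequentially. a < left_end \<mu> (map X [0..<n]) \<and> right_end \<mu> (map X [0..<n]) < b"
    using order_tendstoD(1)[OF ends_tendsto_cdf_map(1) assms(1)]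
      order_tendstoD(2)[OF ends_tendsto_cdf_map(2) assms(2)] by (rule eventually_conj)
  then show thesis using that unfolding eventually_sequentially by blast
qed

lemma measure_cdf_map_le:
  "measure \<mu> {X. a < cdf_map \<mu> X \<and> cdf_map \<mu> X < b} \<le> max 0 (min b 1 - max a 0)"
proof -
  \<comment> \<open>Membership of \<open>X\<close> in the cylinders of \<open>S n\<close> certifies
    after \<open>n\<close> bits that \<open>cdf_map \<mu> X\<close> lies between \<open>a\<close>
    and \<open>b\<close>. These events increase with \<open>n\<close>, and they exhaust the whole
    event since both ends converge.\<close>
  define S where "S n = {\<tau>. length \<tau> = n \<and> a < left_end \<mu> \<tau> \<and> right_end \<mu> \<tau> < b}" for n
  have S: "X \<in> cylinders (S n) \<longleftrightarrow> a < left_end \<mu> (map X [0..<n]) \<and> right_end \<mu> (map X [0..<n]) < b" for X n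
  proof -
    have eq: "X \<in> cylinder \<tau> \<and> length \<tau> = n \<longleftrightarrow> \<tau> = map X [0..<n]" for \<tau>
      by (metis mem_cylinder_iff mem_cylinder_map_upt length_map length_upt diff_zero)
    have "X \<in> cylinders (S n) \<longleftrightarrow>
      (\<exists>\<tau>. (X \<in> cylinder \<tau> \<and> length \<tau> = n) \<and> a < left_end \<mu> \<tau> \<and> right_end \<mu> \<tau> < b)"
      unfolding cylinders_def S_def by blast
    then show ?thesis unfolding eq by simp
  qed
  have "{X. a < cdf_map \<mu> X \<and> cdf_map \<mu> X < b} = (\<Union>n. cylinders (S n))"
  proof (intro set_eqI iffI)
    fix X assume "X \<in> {X. a < cdf_map \<mu> X \<and> cdf_map \<mu> X < b}"
    then have "a < cdf_map \<mu> X" "cdf_map \<mu> X < b" by auto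
    then obtain n where "a < left_end \<mu> (map X [0..<n])" "right_end \<mu> (map X [0..<n]) < b"
      by (rule cdf_map_nested)
    then show "X \<in> (\<Union>n. cylinders (S n))" by (intro UN_I[of n]) (simp_all add: S)
  next
    fix X assume "X \<in> (\<Union>n. cylinders (S n))"
    then obtain n where "a < left_end \<mu> (map X [0..<n])" "right_end \<mu> (map X [0..<n]) < b"
      using S by blast
    then show "X \<in> {X. a < cdf_map \<mu> X \<and> cdf_map \<mu> X < b}" using cdf_map_bounds[of X n] by auto
  qed
  moreover have "(\<lambda>n. measure \<mu> (cylinders (S n))) \<longlonglongrightarrow> measure \<mu> (\<Union>n. cylinders (S n))"
  proof (rule finite_Lim_measure_incseq)
    show "incseq (\<lambda>n. cylinders (S n))"
    proof (rule incseq_SucI, rule subsetI)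
      fix n X assume "X \<in> cylinders (S n)"
      then show "X \<in> cylinders (S (Suc n))"
        unfolding S using ends_mono[OF prefix_map_upt[of n "Suc n" X]] by auto
    qed
  qed (simp add: open_cylinders image_subset_iff)
  moreover have "measure \<mu> (cylinders (S n)) \<le> max 0 (min b 1 - max a 0)" for n
  proof -
    have fin: "finite {\<tau>::bool list. length \<tau> = n}" using finite_lists_length_eq[of "UNIV :: bool set" n] by simp
    have "measure \<mu> (cylinders (S n)) \<le> (\<Sum>\<tau>\<in>S n. measure \<mu> (cylinder \<tau>))"
      unfolding cylinders_def
      by (rule finite_measure_subadditive_finite) (auto simp: S_def open_cylinder intro: finite_subset[OF _ fin])
    also have "S n = {\<tau> \<in> {\<tau>. length \<tau> = n}. a < left_end \<mu> \<tau> \<and> right_end \<mu> \<tau> < b}" by (auto simp: S_def)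
    also have "(\<Sum>\<tau>\<in>\<dots>. measure \<mu> (cylinder \<tau>)) = (\<Sum>\<tau> | length \<tau> = n. if a < left_end \<mu> \<tau> \<and> right_end \<mu> \<tau> < b
      then measure \<mu> (cylinder \<tau>) else 0)" by (rule sum.inter_filter[OF fin])
    also have "\<dots> \<le> max 0 (min b 1 - max a 0)" using sum_measure_strings_le[of a "[]" b n] by (simp cong: if_cong)
    finally show ?thesis by (simp add: S_def)
  qed
  ultimately show ?thesis by (simp add: LIMSEQ_le_const2)
qed

lemma cdf_map_0_1: "0 \<le> cdf_map \<mu> X" "cdf_map \<mu> X \<le> 1"
  using cdf_map_bounds[of X 0] by simp_all

text \<open>The bound of \<open>measure_cdf_map_le\<close>, applied to the event and to its
  complement, leaves room for one value only.\<close>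

lemma measure_cdf_map_atMost: "measure \<mu> {X. cdf_map \<mu> X \<le> t} = min 1 (max 0 t)"
proof -
  consider "t < 0" | "1 \<le> t" | "0 \<le> t" "t < 1" by linarith
  then show ?thesis
  proof cases
    case 1
    then have "{X. cdf_map \<mu> X \<le> t} = {}" using cdf_map_0_1(1) by (auto simp: not_le intro: less_le_trans)
    then show ?thesis using 1 by simp
  next
    case 2
    then have "{X. cdf_map \<mu> X \<le> t} = space \<mu>" using cdf_map_0_1(2) by (auto intro: order_trans)
    then show ?thesis using 2 prob_space by simp
  next
    case 3
    have "measure \<mu> {X. cdf_map \<mu> X \<le> t} \<le> t"
    proof (rule dense_ge)
      fix b assume "t < b"
      have "{X. cdf_map \<mu> X \<le> t} \<subseteq> {X. -1 < cdf_map \<mu> X \<and> cdf_map \<mu> X < b}"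
        using \<open>t < b\<close> by (auto intro: less_le_trans[OF _ cdf_map_0_1(1)])
      then have "measure \<mu> {X. cdf_map \<mu> X \<le> t} \<le> measure \<mu> {X. -1 < cdf_map \<mu> X \<and> cdf_map \<mu> X < b}"
        by (rule finite_measure_mono) (use measurable_cdf_map in measurable)
      also have "\<dots> \<le> max 0 (min b 1 - max (-1) 0)" by (rule measure_cdf_map_le)
      also have "\<dots> \<le> b" using 3 \<open>t < b\<close> by auto
      finally show "measure \<mu> {X. cdf_map \<mu> X \<le> t} \<le> b" .
    qed
    moreover have "1 - t \<ge> 1 - measure \<mu> {X. cdf_map \<mu> X \<le> t}"
    proof -
      have m: "{X. cdf_map \<mu> X \<le> t} \<in> sets \<mu>"
        using measurable_sets[OF measurable_cdf_map, of "{..t}"] by (simp add: vimage_def)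
      have "1 - measure \<mu> {X. cdf_map \<mu> X \<le> t} = measure \<mu> (space \<mu> - {X. cdf_map \<mu> X \<le> t})"
        by (rule prob_compl[OF m, symmetric])
      also have "space \<mu> - {X. cdf_map \<mu> X \<le> t} = {X. t < cdf_map \<mu> X \<and> cdf_map \<mu> X < 2}"
        by (auto simp: not_le intro: le_less_trans[OF cdf_map_0_1(2)])
      also have "measure \<mu> \<dots> \<le> max 0 (min 2 1 - max t 0)" by (rule measure_cdf_map_le)
      also have "\<dots> = 1 - t" using 3 by simp
      finally show ?thesis .
    qed
    ultimately show ?thesis using 3 by simp
  qed
qed

lemma real_distribution_cdf_map: "real_distribution (distr \<mu> borel (cdf_map \<mu>))"
proof -
  interpret d: prob_space "distr \<mu> borel (cdf_map \<mu>)" by (rule prob_space_distr) simp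
  show ?thesis by standard simp_all
qed

lemma cdf_cdf_map: "cdf (distr \<mu> borel (cdf_map \<mu>)) t = min 1 (max 0 t)"
  using measure_cdf_map_atMost[of t] by (simp add: cdf_def measure_distr vimage_def)

text \<open>A point is enclosed in open intervals of arbitrarily small length.\<close>

lemma AE_cdf_map_neq: "AE X in \<mu>. cdf_map \<mu> X \<noteq> p"
proof -
  have m: "{X. cdf_map \<mu> X = p} \<in> sets \<mu>"
    using measurable_sets[OF measurable_cdf_map, of "{p}"] by (simp add: vimage_def)
  have "measure \<mu> {X. cdf_map \<mu> X = p} \<le> 0"
  proof (rule field_le_epsilon)
    fix e :: real assume "e > 0"
    have "{X. cdf_map \<mu> X = p} \<subseteq> {X. p - e / 2 < cdf_map \<mu> X \<and> cdf_map \<mu> X < p + e / 2}"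
      using \<open>e > 0\<close> by auto
    then have "measure \<mu> {X. cdf_map \<mu> X = p} \<le> measure \<mu> {X. p - e / 2 < cdf_map \<mu> X \<and> cdf_map \<mu> X < p + e / 2}"
      by (rule finite_measure_mono) (use measurable_cdf_map in measurable)
    also have "\<dots> \<le> max 0 (min (p + e / 2) 1 - max (p - e / 2) 0)" by (rule measure_cdf_map_le)
    also have "\<dots> \<le> 0 + e" using \<open>e > 0\<close> by auto
    finally show "measure \<mu> {X. cdf_map \<mu> X = p} \<le> 0 + e" .
  qed
  then have "measure \<mu> {X. cdf_map \<mu> X = p} = 0" by (simp add: measure_le_0_iff)
  then have "{X. cdf_map \<mu> X = p} \<in> null_sets \<mu>" using m by (simp add: null_sets_def emeasure_eq_measure)
  then show ?thesis by (rule AE_I') auto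
qed

text \<open>There are only countably many end points, so almost surely \<open>cdf_map\<close> avoids
  them all. Boundary cases then vanish, and an interior value determines the string of the given
  length.\<close>

lemma cdf_map_between_iff:
  "AE X in \<mu>. \<forall>\<sigma>. X \<in> cylinder \<sigma> \<longleftrightarrow> left_end \<mu> \<sigma> < cdf_map \<mu> X \<and> cdf_map \<mu> X < right_end \<mu> \<sigma>"
proof -
  have "AE X in \<mu>. \<forall>\<sigma>. cdf_map \<mu> X \<noteq> left_end \<mu> \<sigma> \<and> cdf_map \<mu> X \<noteq> right_end \<mu> \<sigma>"
    unfolding AE_all_countable using AE_cdf_map_neq by auto
  then show ?thesis
  proof (rule AE_mp, intro AE_I2 impI allI)
    fix X \<sigma> assume neq: "\<forall>\<sigma>. cdf_map \<mu> X \<noteq> left_end \<mu> \<sigma> \<and> cdf_map \<mu> X \<noteq> right_end \<mu> \<sigma>"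
    show "X \<in> cylinder \<sigma> \<longleftrightarrow> left_end \<mu> \<sigma> < cdf_map \<mu> X \<and> cdf_map \<mu> X < right_end \<mu> \<sigma>"
    proof
      assume "X \<in> cylinder \<sigma>"
      then show "left_end \<mu> \<sigma> < cdf_map \<mu> X \<and> cdf_map \<mu> X < right_end \<mu> \<sigma>"
        using cdf_map_mem[of X \<sigma>] neq by (metis order_le_less)
    next
      assume "left_end \<mu> \<sigma> < cdf_map \<mu> X \<and> cdf_map \<mu> X < right_end \<mu> \<sigma>"
      then have "comparable \<sigma> (map X [0..<length \<sigma>])"
        using comparable_of_overlap cdf_map_bounds by blast
      then show "X \<in> cylinder \<sigma>"
        using not_equal_is_parallel[of \<sigma> "map X [0..<length \<sigma>]"]
        unfolding mem_cylinder_iff comparable_def parallel_def by (metis diff_zero length_map length_upt)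
    qed
  qed
qed

end

section \<open>Transport between two atomless measures\<close>

text \<open>Both distribution maps have the uniform law, so the union \<open>G\<close> of the open
  intervals of the strings in \<open>A\<close> has the same probability under either. Up to null
  sets, its preimage is the union of the cylinders of \<open>A\<close> on one side and of the
  transported strings on the other.\<close>

lemma measure_transport:
  assumes "atomless_cantor_measure \<mu>" "atomless_cantor_measure \<nu>"
  shows "measure \<nu> (cylinders (transport \<mu> \<nu> A)) = measure \<mu> (cylinders A)"
proof -
  interpret mu: atomless_cantor_measure \<mu> by fact
  interpret nu: atomless_cantor_measure \<nu> by fact
  define G where "G = (\<Union>\<rho>\<in>A. {left_end \<mu> \<rho> <..< right_end \<mu> \<rho>})"
  have G: "G \<in> sets borel" unfolding G_def by (intro borel_open open_UN ballI open_greaterThanLessThan)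
  have vG: "cdf_map \<nu> -` G \<in> sets \<nu>" "cdf_map \<mu> -` G \<in> sets \<mu>"
    using measurable_sets[OF nu.measurable_cdf_map G] measurable_sets[OF mu.measurable_cdf_map G] by simp_all
  have "distr \<nu> borel (cdf_map \<nu>) = distr \<mu> borel (cdf_map \<mu>)"
    by (rule cdf_unique[OF nu.real_distribution_cdf_map mu.real_distribution_cdf_map])
      (simp add: fun_eq_iff nu.cdf_cdf_map mu.cdf_cdf_map)
  then have "measure \<nu> (cdf_map \<nu> -` G) = measure \<mu> (cdf_map \<mu> -` G)"
    using measure_distr[OF nu.measurable_cdf_map G] measure_distr[OF mu.measurable_cdf_map G] by simp
  moreover have "measure \<mu> (cdf_map \<mu> -` G) = measure \<mu> (cylinders A)"
  proof (rule mu.finite_measure_eq_AE[OF _ vG(2) mu.sets_cylinders])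
    show "AE X in \<mu>. (X \<in> cdf_map \<mu> -` G) = (X \<in> cylinders A)"
      using mu.cdf_map_between_iff by eventually_elim (auto simp: G_def cylinders_def)
  qed
  moreover have "measure \<nu> (cylinders (transport \<mu> \<nu> A)) = measure \<nu> (cdf_map \<nu> -` G)"
  proof (rule nu.finite_measure_eq_AE[OF _ nu.sets_cylinders vG(1)])
    \<comment> \<open>\<open>fits_in\<close> demands a nondegenerate interval, so the null
      cylinders, countably many, are discarded first.\<close>
    have "AE X in \<nu>. X \<in> cylinder \<sigma> \<longrightarrow> measure \<nu> (cylinder \<sigma>) \<noteq> 0" for \<sigma>
    proof (cases "measure \<nu> (cylinder \<sigma>) = 0")
      case True
      then have "cylinder \<sigma> \<in> null_sets \<nu>" using nu.sets_cylinder by (simp add: null_sets_def nu.emeasure_eq_measure)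
      then show ?thesis by (rule AE_I') auto
    qed simp
    then have "AE X in \<nu>. \<forall>\<sigma>. X \<in> cylinder \<sigma> \<longrightarrow> measure \<nu> (cylinder \<sigma>) \<noteq> 0"
      unfolding AE_all_countable by blast
    then show "AE X in \<nu>. (X \<in> cylinders (transport \<mu> \<nu> A)) = (X \<in> cdf_map \<nu> -` G)"
    proof (eventually_elim, intro iffI)
      fix X assume "X \<in> cylinders (transport \<mu> \<nu> A)"
      then show "X \<in> cdf_map \<nu> -` G"
        unfolding cylinders_def transport_def fits_in_def G_def using nu.cdf_map_mem[of X] by fastforce
    next
      fix X assume pos: "\<forall>\<sigma>. X \<in> cylinder \<sigma> \<longrightarrow> measure \<nu> (cylinder \<sigma>) \<noteq> 0" and "X \<in> cdf_map \<nu> -` G"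
      then obtain \<rho> where \<rho>: "\<rho> \<in> A" "left_end \<mu> \<rho> < cdf_map \<nu> X" "cdf_map \<nu> X < right_end \<mu> \<rho>"
        unfolding G_def by auto
      \<comment> \<open>The intervals of the prefixes of \<open>X\<close> shrink to a value interior
        to the \<mu>-interval of \<rho>, so a long enough prefix fits.\<close>
      obtain n where n: "left_end \<mu> \<rho> < left_end \<nu> (map X [0..<n])" "right_end \<nu> (map X [0..<n]) < right_end \<mu> \<rho>"
        using nu.cdf_map_nested[OF \<rho>(2,3)] .
      have "measure \<nu> (cylinder (map X [0..<n])) > 0"
        using pos by (simp add: zero_less_measure_iff)
      then have "map X [0..<n] \<in> transport \<mu> \<nu> A"
        unfolding transport_def fits_in_def using n \<rho>(1) by (auto simp: right_end_def)
      then show "X \<in> cylinders (transport \<mu> \<nu> A)"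
        unfolding cylinders_def using mem_cylinder_map_upt by blast
    qed
  qed
  ultimately show ?thesis by simp
qed

section \<open>Effectiveness and order properties of \<open>fits_in\<close>\<close>

lemma effective_string_comp:
  assumes "effective (\<lambda>n. x (string_decode n))" "computable (\<lambda>n. string_code (f n))"
  shows "effective (\<lambda>n. x (f n))"
  using effective_comp[OF assms] by simp

text \<open>A proper prefix has a smaller code, so the sum over strings becomes a bounded sum, as
  \<open>effective_sum\<close> requires.\<close>

lemma left_end_eq_sum_codes:
  "left_end \<mu> \<sigma> = (\<Sum>t<string_code \<sigma>. if prefix (string_decode t @ [True]) \<sigma>
     then measure \<mu> (cylinder (string_decode t @ [False])) else 0)"
proof -
  have less: "string_code \<tau> < string_code \<sigma>" if "prefix (\<tau> @ [True]) \<sigma>" for \<tau>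
    using that by (auto simp: prefix_def string_code_append)
  have "string_code ` {\<tau>. prefix (\<tau> @ [True]) \<sigma>} =
      {t \<in> {..<string_code \<sigma>}. prefix (string_decode t @ [True]) \<sigma>}"
    using less by (auto intro!: image_eqI[of _ string_code "string_decode _"])
  then have "(\<Sum>t<string_code \<sigma>. if prefix (string_decode t @ [True]) \<sigma>
     then measure \<mu> (cylinder (string_decode t @ [False])) else 0) =
     (\<Sum>t\<in>string_code ` {\<tau>. prefix (\<tau> @ [True]) \<sigma>}. measure \<mu> (cylinder (string_decode t @ [False])))"
    by (simp only: sum.inter_filter[OF finite_lessThan])
  also have "\<dots> = left_end \<mu> \<sigma>"
    unfolding left_end_def by (subst sum.reindex) (auto simp: inj_on_def)
  finally show ?thesis ..
qed

lemma effective_ends: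
  assumes "computable_measure \<mu>" "computable (\<lambda>n. string_code (f n))"
  shows "effective (\<lambda>n. left_end \<mu> (f n))" "effective (\<lambda>n. right_end \<mu> (f n))"
proof -
  note cyl = effective_string_comp[OF computable_measure_effective[OF assms(1)]]
  show 1: "effective (\<lambda>n. left_end \<mu> (f n))"
    unfolding left_end_eq_sum_codes
    by (intro effective_sum effective_if cyl computable_intros assms(2) computable_comp[OF assms(2)])
  show "effective (\<lambda>n. right_end \<mu> (f n))"
    unfolding right_end_def by (intro effective_add 1 cyl assms(2))
qed

text \<open>Strict comparison of computable reals is semidecidable; this is one reason for the
  strict inequalities in \<open>fits_in\<close>.\<close>

lemma semidecidable_fits_in:
  assumes "computable_measure \<mu>" "computable_measure \<nu>"
    and "computable (\<lambda>n. string_code (f n))" "computable (\<lambda>n. string_code (g n))"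
  shows "semidecidable (\<lambda>n. fits_in \<mu> (f n) \<nu> (g n))"
  unfolding fits_in_def
  by (intro semidecidable_conj semidecidable_effective_less effective_ends assms)

lemma fits_in_trans: "fits_in \<mu> \<rho> \<nu> \<pi> \<Longrightarrow> fits_in \<nu> \<pi> \<kappa> \<tau> \<Longrightarrow> fits_in \<mu> \<rho> \<kappa> \<tau>"
  by (simp add: fits_in_def)

lemma fits_in_pos: "fits_in \<mu> \<rho> \<nu> \<pi> \<Longrightarrow> 0 < measure \<nu> (cylinder \<pi>)"
  by (simp add: fits_in_def right_end_def)

lemma (in cantor_measure) fits_in_prefix:
  "fits_in \<mu> \<rho> \<nu> \<pi> \<Longrightarrow> prefix \<rho>' \<rho> \<Longrightarrow> fits_in \<mu> \<rho>' \<nu> \<pi>"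
  using ends_mono[of \<rho>' \<rho>] by (simp add: fits_in_def)

text \<open>Overlapping intervals give comparability, and the strictly larger left end prevents
  \<pi> from being a prefix of \<rho>.\<close>

lemma (in cantor_measure) prefix_if_fits_in:
  assumes "fits_in \<mu> \<rho> \<mu> \<pi>" shows "prefix \<rho> \<pi>"
proof -
  have "comparable \<rho> \<pi>"
    using assms comparable_of_overlap[of \<rho> "left_end \<mu> \<pi>" \<pi>] by (simp add: fits_in_def)
  moreover have "\<not> prefix \<pi> \<rho>"
    using assms ends_mono(1)[of \<pi> \<rho>] by (auto simp: fits_in_def)
  ultimately show ?thesis by (simp add: comparable_def)
qed

lemma comparable_sym: "comparable \<sigma> \<tau> \<longleftrightarrow> comparable \<tau> \<sigma>"
  by (auto simp: comparable_def)

text \<open>The left end of the longer of \<open>\<pi>\<^sub>1\<close> and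
  \<open>\<pi>\<^sub>2\<close> is interior to the intervals of both \<open>\<rho>\<^sub>1\<close>
  and \<open>\<rho>\<^sub>2\<close>. Consistency of transported machines rests on this.\<close>

lemma comparable_if_fits_in:
  assumes "cantor_measure \<mu>" "cantor_measure \<nu>"
    and "fits_in \<mu> \<rho>\<^sub>1 \<nu> \<pi>\<^sub>1" "fits_in \<mu> \<rho>\<^sub>2 \<nu> \<pi>\<^sub>2" "comparable \<pi>\<^sub>1 \<pi>\<^sub>2"
  shows "comparable \<rho>\<^sub>1 \<rho>\<^sub>2"
proof -
  interpret mu: cantor_measure \<mu> by fact
  interpret nu: cantor_measure \<nu> by fact
  have *: "comparable \<rho>\<^sub>1 \<rho>\<^sub>2" if "fits_in \<mu> \<rho>\<^sub>1 \<nu> \<pi>\<^sub>1" "fits_in \<mu> \<rho>\<^sub>2 \<nu> \<pi>\<^sub>2" "prefix \<pi>\<^sub>1 \<pi>\<^sub>2" for \<rho>\<^sub>1 \<rho>\<^sub>2 \<pi>\<^sub>1 \<pi>\<^sub>2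
    using mu.comparable_of_overlap[of \<rho>\<^sub>1 "left_end \<nu> \<pi>\<^sub>2" \<rho>\<^sub>2] nu.ends_mono[OF that(3)] that(1,2)
    by (simp add: fits_in_def)
  show ?thesis
    using assms(5) *[OF assms(3,4)] *[OF assms(4,3)] comparable_sym
    unfolding comparable_def[of \<pi>\<^sub>1] by metis
qed

text \<open>Otherwise the transport of the single string \<rho> would be empty, although transport
  preserves the positive measure of its cylinder.\<close>

lemma ex_fits_in:
  assumes "atomless_cantor_measure \<mu>" "atomless_cantor_measure \<nu>" "0 < measure \<mu> (cylinder \<rho>)"
  shows "\<exists>\<pi>. fits_in \<mu> \<rho> \<nu> \<pi>"
proof (rule ccontr)
  assume "\<not> ?thesis"
  then have "cylinders (transport \<mu> \<nu> {\<rho>}) = {}" by (simp add: transport_def cylinders_def)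
  with measure_transport[OF assms(1,2), of "{\<rho>}"] assms(3) show False by (simp add: cylinders_def)
qed

lemma atomless_cantor_measureI:
  assumes "computable_measure \<mu>" "continuous_measure \<mu>"
  shows "atomless_cantor_measure \<mu>"
  using assms unfolding computable_measure_def continuous_measure_def
    atomless_cantor_measure_def cantor_measure_def cantor_measure_axioms_def atomless_cantor_measure_axioms_def
  by simp

lemma continuous_measure_fair_coin: "continuous_measure fair_coin_measure"
  unfolding continuous_measure_def
proof
  fix X :: "nat \<Rightarrow> bool"
  interpret prob_space fair_coin_measure by (rule prob_space_fair_coin_measure)
  have "measure fair_coin_measure {X} \<le> (1 / 2) ^ n" for n
  proof -
    have "measure fair_coin_measure {X} \<le> measure fair_coin_measure (cylinder (map X [0..<n]))"
      by (rule finite_measure_mono) (simp_all add: sets_fair_coin_measure open_cylinder)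
    then show ?thesis by (simp add: fair_coin_measure_cylinder)
  qed
  moreover have "(\<lambda>n. (1 / 2) ^ n) \<longlonglongrightarrow> (0::real)" by (rule LIMSEQ_power_zero) simp
  ultimately have "measure fair_coin_measure {X} \<le> 0" by (intro LIMSEQ_le_const) auto
  then show "measure fair_coin_measure {X} = 0" by (simp add: measure_le_0_iff)
qed

section \<open>Universal machines\<close>

text \<open>The combinatorial half of \<open>monotone_machine\<close> in symmetric form, kept apart
  from enumerability.\<close>

definition consistent :: "(bool list \<times> bool list) set \<Rightarrow> bool" where
  "consistent M \<longleftrightarrow> (\<forall>(\<rho>\<^sub>1, \<sigma>\<^sub>1) \<in> M. \<forall>(\<rho>\<^sub>2, \<sigma>\<^sub>2) \<in> M. comparable \<rho>\<^sub>1 \<rho>\<^sub>2 \<longrightarrow> comparable \<sigma>\<^sub>1 \<sigma>\<^sub>2)"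

lemma consistentD:
  "consistent M \<Longrightarrow> (\<rho>\<^sub>1, \<sigma>\<^sub>1) \<in> M \<Longrightarrow> (\<rho>\<^sub>2, \<sigma>\<^sub>2) \<in> M \<Longrightarrow> comparable \<rho>\<^sub>1 \<rho>\<^sub>2 \<Longrightarrow> comparable \<sigma>\<^sub>1 \<sigma>\<^sub>2"
  unfolding consistent_def by fast

lemma monotone_machine_iff: "monotone_machine M \<longleftrightarrow> uniformly_ce (\<lambda>_. M) \<and> consistent M"
  unfolding monotone_machine_def consistent_def ce_pairs_iff_uniformly_ce comparable_def by fast

lemma consistent_subset: "consistent M \<Longrightarrow> N \<subseteq> M \<Longrightarrow> consistent N"
  unfolding consistent_def by fast

definition residual :: "bool list \<Rightarrow> (bool list \<times> bool list) set \<Rightarrow> (bool list \<times> bool list) set" where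
  "residual \<tau> M = {(\<pi>, \<sigma>). (\<tau> @ \<pi>, \<sigma>) \<in> M}"

lemma consistent_residual: "consistent M \<Longrightarrow> consistent (residual \<tau> M)"
  unfolding consistent_def residual_def by (fastforce simp: comparable_def)

lemma monotone_machine_residual:
  assumes "monotone_machine M" shows "monotone_machine (residual \<tau> M)"
  unfolding monotone_machine_iff
proof
  show "uniformly_ce (\<lambda>_. residual \<tau> M)"
    unfolding residual_def using assms unfolding monotone_machine_iff
    by (intro uniformly_ceI semidecidable_uniformly_ce[where N = "\<lambda>_. M" and e = "\<lambda>_. 0"] computable_intros) auto
qed (use assms in \<open>simp add: monotone_machine_iff consistent_residual\<close>)

definition transport_machine ::
  "(nat \<Rightarrow> bool) measure \<Rightarrow> (nat \<Rightarrow> bool) measure \<Rightarrow> (bool list \<times> bool list) set \<Rightarrow> (bool list \<times> bool list) set" where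
  "transport_machine \<mu> \<nu> M = {(\<pi>, \<sigma>). \<exists>\<rho>. (\<rho>, \<sigma>) \<in> M \<and> fits_in \<mu> \<rho> \<nu> \<pi>}"

lemma consistent_transport_machine:
  assumes "cantor_measure \<mu>" "cantor_measure \<nu>" "consistent M"
  shows "consistent (transport_machine \<mu> \<nu> M)"
  unfolding consistent_def transport_machine_def
  using comparable_if_fits_in[OF assms(1,2)] consistentD[OF assms(3)] by blast

text \<open>Transport changes inputs only, so it commutes with collecting the inputs whose output
  extends a given string.\<close>

lemma transformation_transport_machine:
  assumes "atomless_cantor_measure \<mu>" "atomless_cantor_measure \<nu>"
  shows "transformation \<nu> (transport_machine \<mu> \<nu> M) = transformation \<mu> M"
proof
  fix \<sigma>
  have "{\<rho>. \<exists>\<sigma>'. prefix \<sigma> \<sigma>' \<and> (\<rho>, \<sigma>') \<in> transport_machine \<mu> \<nu> M} =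
      transport \<mu> \<nu> {\<rho>. \<exists>\<sigma>'. prefix \<sigma> \<sigma>' \<and> (\<rho>, \<sigma>') \<in> M}"
    by (auto simp: transport_machine_def transport_def)
  then show "transformation \<nu> (transport_machine \<mu> \<nu> M) \<sigma> = transformation \<mu> M \<sigma>"
    unfolding transformation_def by (simp add: measure_transport[OF assms])
qed

text \<open>Incomparable strings have disjoint cylinders, so additivity applies.\<close>

lemma (in cantor_measure) transformation_Un:
  assumes "\<And>\<rho> \<sigma> \<tau> \<upsilon>. (\<rho>, \<sigma>) \<in> M \<Longrightarrow> (\<tau>, \<upsilon>) \<in> N \<Longrightarrow> \<not> comparable \<rho> \<tau>"
  shows "transformation \<mu> (M \<union> N) \<sigma> = transformation \<mu> M \<sigma> + transformation \<mu> N \<sigma>"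
proof -
  let ?D = "\<lambda>M. {\<rho>. \<exists>\<sigma>'. prefix \<sigma> \<sigma>' \<and> (\<rho>, \<sigma>') \<in> M}"
  have "cylinders (?D (M \<union> N)) = cylinders (?D M) \<union> cylinders (?D N)"
    unfolding cylinders_def by blast
  moreover have "cylinders (?D M) \<inter> cylinders (?D N) = {}"
    unfolding cylinders_def using assms comparable_cylinder by blast
  ultimately show ?thesis
    unfolding transformation_def using finite_measure_Union[OF sets_cylinders sets_cylinders] by presburger
qed

lemma comparable_append_cancel: "comparable (\<alpha> @ \<sigma>) (\<alpha> @ \<tau>) \<longleftrightarrow> comparable \<sigma> \<tau>"
  by (simp add: comparable_def)

lemma comparable_append_left: "comparable (\<sigma> @ \<upsilon>) \<tau> \<Longrightarrow> comparable \<sigma> \<tau>"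
  unfolding comparable_def by (metis prefix_append prefix_def prefix_order.trans prefix_same_cases)

lemma comparable_append:
  "comparable (\<sigma> @ \<upsilon>) (\<tau> @ \<phi>) \<Longrightarrow> comparable \<sigma> \<tau>"
  using comparable_append_left comparable_sym by blast

lemma comparable_nth: "comparable \<sigma> \<tau> \<Longrightarrow> i < length \<sigma> \<Longrightarrow> i < length \<tau> \<Longrightarrow> \<sigma> ! i = \<tau> ! i"
  by (auto simp: comparable_def prefix_def nth_append)

section \<open>Encodings, and universal machines as adjunctions\<close>

lemma encoding_iff:
  "encoding \<rho> \<longleftrightarrow> computable_strings \<rho> \<and> (\<forall>e e'. comparable (\<rho> e) (\<rho> e') \<longrightarrow> e = e')"
proof
  assume "encoding \<rho>"
  then show "computable_strings \<rho> \<and> (\<forall>e e'. comparable (\<rho> e) (\<rho> e') \<longrightarrow> e = e')"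
    unfolding encoding_def comparable_def by (metis injD rangeI)
next
  assume *: "computable_strings \<rho> \<and> (\<forall>e e'. comparable (\<rho> e) (\<rho> e') \<longrightarrow> e = e')"
  then have "inj \<rho>" unfolding comparable_def by (intro injI) simp
  with * show "encoding \<rho>" unfolding encoding_def comparable_def by blast
qed

definition adjunction ::
  "(nat \<Rightarrow> bool list) \<Rightarrow> (nat \<Rightarrow> (bool list \<times> bool list) set) \<Rightarrow> (bool list \<times> bool list) set" where
  "adjunction \<rho> M = {(\<tau>, \<sigma>). \<exists>e \<pi>. \<tau> = \<rho> e @ \<pi> \<and> (\<pi>, \<sigma>) \<in> M e}"

lemma mem_adjunction_iff:
  assumes "\<And>e e'. comparable (\<rho> e) (\<rho> e') \<Longrightarrow> e = e'"
  shows "(\<rho> e @ \<pi>, \<sigma>) \<in> adjunction \<rho> M \<longleftrightarrow> (\<pi>, \<sigma>) \<in> M e"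
proof
  assume "(\<rho> e @ \<pi>, \<sigma>) \<in> adjunction \<rho> M"
  then obtain e' \<pi>' where *: "\<rho> e @ \<pi> = \<rho> e' @ \<pi>'" "(\<pi>', \<sigma>) \<in> M e'" unfolding adjunction_def by blast
  have "comparable (\<rho> e @ \<pi>) (\<rho> e' @ \<pi>')" unfolding *(1) by (simp add: comparable_def)
  then have "e = e'" by (rule assms[OF comparable_append])
  with * show "(\<pi>, \<sigma>) \<in> M e" by simp
qed (auto simp: adjunction_def)

text \<open>The equivalence on extensions of codewords and the restriction on inputs together leave
  no freedom in \<open>U\<close> once \<rho> and \<open>M\<close> are given.\<close>

lemma universal_via_iff:
  "universal_via U \<rho> \<longleftrightarrow> encoding \<rho> \<and> (\<exists>M. machine_enumeration M \<and> U = adjunction \<rho> M)"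
proof
  assume "universal_via U \<rho>"
  then obtain M where "encoding \<rho>" "machine_enumeration M"
    and M: "\<And>e \<pi> \<sigma>. (\<rho> e @ \<pi>, \<sigma>) \<in> U \<longleftrightarrow> (\<pi>, \<sigma>) \<in> M e" "\<forall>(\<tau>, \<sigma>) \<in> U. \<exists>e \<pi>. \<tau> = \<rho> e @ \<pi>"
    unfolding universal_via_def by blast
  moreover have "U = adjunction \<rho> M"
    unfolding adjunction_def M(1)[symmetric] using M(2) by fastforce
  ultimately show "encoding \<rho> \<and> (\<exists>M. machine_enumeration M \<and> U = adjunction \<rho> M)" by blast
next
  assume "encoding \<rho> \<and> (\<exists>M. machine_enumeration M \<and> U = adjunction \<rho> M)"
  then obtain M where M: "encoding \<rho>" "machine_enumeration M" "U = adjunction \<rho> M" by blast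
  have "(\<rho> e @ \<pi>, \<sigma>) \<in> U \<longleftrightarrow> (\<pi>, \<sigma>) \<in> M e" for e \<pi> \<sigma>
    unfolding M(3) by (rule mem_adjunction_iff) (use M(1) in \<open>simp add: encoding_iff\<close>)
  moreover have "\<forall>(\<tau>, \<sigma>) \<in> U. \<exists>e \<pi>. \<tau> = \<rho> e @ \<pi>"
    unfolding M(3) adjunction_def by blast
  ultimately show "universal_via U \<rho>" unfolding universal_via_def using M(1,2) by blast
qed

lemma consistent_adjunction:
  assumes "\<And>e e'. comparable (\<rho> e) (\<rho> e') \<Longrightarrow> e = e'" "\<And>e. consistent (M e)"
  shows "consistent (adjunction \<rho> M)"
  unfolding consistent_def
proof (clarify)
  fix \<tau> \<sigma> \<tau>' \<sigma>' assume "(\<tau>, \<sigma>) \<in> adjunction \<rho> M" "(\<tau>', \<sigma>') \<in> adjunction \<rho> M" and c: "comparable \<tau> \<tau>'"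
  then obtain e \<pi> e' \<pi>' where *: "\<tau> = \<rho> e @ \<pi>" "(\<pi>, \<sigma>) \<in> M e" "\<tau>' = \<rho> e' @ \<pi>'" "(\<pi>', \<sigma>') \<in> M e'"
    unfolding adjunction_def by blast
  from c have "e = e'" unfolding * by (rule assms(1)[OF comparable_append])
  with * c have "comparable \<pi> \<pi>'" by (simp add: comparable_append_cancel)
  with * \<open>e = e'\<close> show "comparable \<sigma> \<sigma>'" using consistentD[OF assms(2)] by blast
qed

lemma machine_enumeration_consistent:
  assumes "machine_enumeration M"
  shows "monotone_machine (M e)" "consistent (M e)"
proof -
  have "M e \<in> {N. monotone_machine N}"
    using assms unfolding machine_enumeration_def by (metis rangeI)
  then show "monotone_machine (M e)" "consistent (M e)" by (simp_all add: monotone_machine_iff)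
qed

lemma universal_via_monotone_machine:
  assumes "universal_via U \<rho>" shows "monotone_machine U"
proof -
  obtain M where M: "encoding \<rho>" "machine_enumeration M" "U = adjunction \<rho> M"
    using assms universal_via_iff by blast
  have \<rho>: "computable (\<lambda>e. string_code (\<rho> e))" using M(1) by (simp add: encoding_def computable_strings_def)
  have ce: "uniformly_ce M" using M(2) by (simp add: machine_enumeration_def)
  show ?thesis unfolding monotone_machine_iff M(3)
  proof
    show "consistent (adjunction \<rho> M)"
      by (rule consistent_adjunction)
        (use M(1) machine_enumeration_consistent(2)[OF M(2)] in \<open>simp_all add: encoding_iff\<close>)
    \<comment> \<open>\<open>z\<close> codes index, input and output, extended by the witness
      \<open>e\<close> and then by \<pi>.\<close>
    have "semidecidable (\<lambda>z. string_decode (fst (prod_decode (snd (prod_decode (fst (prod_decode (fst (prod_decode z))))))))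
      = \<rho> (snd (prod_decode (fst (prod_decode z)))) @ string_decode (snd (prod_decode z)))"
      unfolding string_code_eq_iff[symmetric]
      by (intro semidecidable_decidable computable_intros computable_comp[OF \<rho>])
    then show "uniformly_ce (\<lambda>_. adjunction \<rho> M)"
      unfolding adjunction_def
      by (intro uniformly_ceI semidecidable_intros) (auto intro!: semidecidable_uniformly_ce[OF ce] computable_intros)
  qed
qed

text \<open>Kleene's recursion theorem for enumerations of monotone machines.  The strings \<open>\<rho> x\<close> serve
  as numerals: a computable function \<open>f\<close> is represented by the machine of all pairs
  \<open>(\<rho> x, \<rho> (f x))\<close>.\<close>

lemma machine_fixed_point:
  assumes M: "machine_enumeration M" and "encoding \<rho>"
    and T: "uniformly_ce T" "\<And>k. monotone_machine (T k)"
  obtains k where "M k = T k"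
proof -
  have \<rho>: "computable (\<lambda>e. string_code (\<rho> e))"
    and \<rho>_inj: "\<And>e e'. comparable (\<rho> e) (\<rho> e') \<Longrightarrow> e = e'" "\<And>e e'. \<rho> e = \<rho> e' \<Longrightarrow> e = e'"
    using assms(2) by (simp_all add: encoding_iff computable_strings_def) (metis comparable_def prefix_order.refl)
  have ce: "uniformly_ce M" and acceptable:
    "\<And>N. uniformly_ce N \<Longrightarrow> (\<And>k. monotone_machine (N k)) \<Longrightarrow> \<exists>h. computable h \<and> (\<forall>k. N k = M (h k))"
    using M by (simp_all add: machine_enumeration_def)
  obtain f where f: "computable f" "\<And>k. T k = M (f k)" using acceptable[OF T] by blast
  \<comment> \<open>The diagonal machine: run machine \<open>x\<close> on its own numeral and, if it
    yields the numeral of \<open>z\<close>, act as \<open>M z\<close>.\<close>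
  define N where "N x = {(\<pi>, \<sigma>). \<exists>z. (\<rho> x, \<rho> z) \<in> M x \<and> (\<pi>, \<sigma>) \<in> M z}" for x
  have N: "N x = M z" if "(\<rho> x, \<rho> z) \<in> M x" for x z
  proof -
    \<comment> \<open>Consistency of \<open>M x\<close> makes its outputs on one input comparable,
      and distinct numerals are incomparable.\<close>
    have eq: "z' = z" if "(\<rho> x, \<rho> z') \<in> M x" for z'
      by (rule \<rho>_inj(1), rule consistentD[OF machine_enumeration_consistent(2)[OF M] that \<open>(\<rho> x, \<rho> z) \<in> M x\<close>])
        (simp add: comparable_def)
    show ?thesis
    proof (intro equalityI subrelI)
      fix \<pi> \<sigma> assume "(\<pi>, \<sigma>) \<in> N x"
      then obtain z' where "(\<rho> x, \<rho> z') \<in> M x" "(\<pi>, \<sigma>) \<in> M z'" unfolding N_def by blast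
      with eq show "(\<pi>, \<sigma>) \<in> M z" by blast
    next
      fix \<pi> \<sigma> assume "(\<pi>, \<sigma>) \<in> M z"
      with that show "(\<pi>, \<sigma>) \<in> N x" unfolding N_def by blast
    qed
  qed
  have N_ce: "uniformly_ce N"
    unfolding N_def by (intro uniformly_ceI semidecidable_intros semidecidable_uniformly_ce[OF ce] computable_intros computable_comp[OF \<rho>])
  have "monotone_machine (N x)" for x
  proof (cases "\<exists>z. (\<rho> x, \<rho> z) \<in> M x")
    case True
    then show ?thesis using N machine_enumeration_consistent(1)[OF M] by metis
  next
    \<comment> \<open>An undefined diagonal value gives the empty machine, so \<open>N\<close>
      consists of monotone machines without exception.\<close>
    case False
    then have "N x = {}" unfolding N_def by blast
    then show ?thesis by (simp add: monotone_machine_def ce_pairs_def ce_def)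
  qed
  with acceptable[OF N_ce] obtain d where d: "computable d" "\<And>x. N x = M (d x)" by blast
  \<comment> \<open>\<open>G\<close> represents \<open>f\<close> composed with \<open>d\<close>.
    With \<open>v\<close> an index of \<open>G\<close>, the index \<open>d v\<close> is as required:
    \<open>M (d v) = N v = M (f (d v)) = T (d v)\<close>.\<close>
  define G where "G = {(\<pi>, \<sigma>). \<exists>x. \<pi> = \<rho> x \<and> \<sigma> = \<rho> (f (d x))}"
  have "monotone_machine G"
    unfolding monotone_machine_iff
  proof
    have c: "computable (\<lambda>x. string_code (\<rho> (f (d x))))"
      by (rule computable_comp[OF \<rho> computable_comp[OF f(1) d(1)]])
    show "uniformly_ce (\<lambda>_. G)"
      unfolding G_def string_code_eq_iff[symmetric]
      by (intro uniformly_ceI semidecidable_intros semidecidable_decidable computable_intros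
        computable_comp[OF \<rho>] computable_comp[OF c])
    show "consistent G"
      unfolding consistent_def G_def using \<rho>_inj(1) by (auto simp: comparable_def)
  qed
  then obtain v where v: "M v = G" using M unfolding machine_enumeration_def by (metis (mono_tags) mem_Collect_eq rangeE)
  have "(\<rho> v, \<rho> (f (d v))) \<in> M v" unfolding v G_def by blast
  then have "M (d v) = T (d v)" using N f(2) d(2) by metis
  then show thesis by (rule that)
qed


section \<open>Enlarging a universal machine by finitely many codewords\<close>

text \<open>Repetitions are allowed in an enumeration, so any machine may be put in front;
  acceptability survives by shifting the indices by one.\<close>

lemma machine_enumeration_case_nat:
  assumes M: "machine_enumeration M" and N: "monotone_machine N"
  shows "machine_enumeration (case_nat N M)"
proof -
  have ce: "uniformly_ce M" "uniformly_ce (\<lambda>_. N)"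
    using M N by (simp_all add: machine_enumeration_def monotone_machine_iff)
  have "p \<in> case_nat N M k \<longleftrightarrow> (k = 0 \<and> p \<in> N) \<or> (k \<noteq> 0 \<and> p \<in> M (k - 1))" for p k
    by (cases k) auto
  then have "case_nat N M = (\<lambda>k. {(\<pi>, \<sigma>). (k = 0 \<and> (\<pi>, \<sigma>) \<in> N) \<or> (k \<noteq> 0 \<and> (\<pi>, \<sigma>) \<in> M (k - 1))})"
    by (intro ext set_eqI) auto
  moreover have "uniformly_ce \<dots>"
    by (intro uniformly_ceI semidecidable_intros semidecidable_uniformly_ce[OF ce(1)]
      semidecidable_uniformly_ce[OF ce(2), where e = "\<lambda>_. 0"] semidecidable_decidable[OF decidable_eq]
      semidecidable_decidable[OF decidable_not] computable_intros)
  ultimately have "uniformly_ce (case_nat N M)" by simp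
  moreover have "range (case_nat N M) = {N. monotone_machine N}"
  proof -
    have "range (case_nat N M) = insert N (range M)"
      by (auto simp: image_iff split: nat.splits)
    then show ?thesis using M N by (auto simp: machine_enumeration_def)
  qed
  moreover have "\<exists>h. computable h \<and> (\<forall>k. L k = case_nat N M (h k))"
    if L: "uniformly_ce L \<and> (\<forall>k. monotone_machine (L k))" for L
  proof -
    obtain h where "computable h" "\<forall>k. L k = M (h k)"
      using M L unfolding machine_enumeration_def by blast
    then show ?thesis by (intro exI[of _ "\<lambda>k. Suc (h k)"]) (simp add: computable_intros)
  qed
  ultimately show ?thesis unfolding machine_enumeration_def by blast
qed

lemma encoding_case_nat:
  assumes "encoding \<rho>" "\<And>e. \<not> comparable s (\<rho> e)"
  shows "encoding (case_nat s \<rho>)"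
  unfolding encoding_iff
proof (intro conjI allI impI)
  have "computable (\<lambda>e. string_code (\<rho> e))"
    using assms(1) by (simp add: encoding_iff computable_strings_def)
  then have "computable (case_nat (string_code s) (\<lambda>e. string_code (\<rho> e)))" by (rule computable_case_nat)
  moreover have "case_nat (string_code s) (\<lambda>e. string_code (\<rho> e)) = (\<lambda>e. string_code (case_nat s \<rho> e))"
    by (rule ext) (simp split: nat.split)
  ultimately show "computable_strings (case_nat s \<rho>)" by (simp add: computable_strings_def)
  fix e e' assume "comparable (case_nat s \<rho> e) (case_nat s \<rho> e')"
  moreover have "\<not> comparable (\<rho> e) s" for e using assms(2) comparable_sym by metis
  moreover have "\<And>e e'. comparable (\<rho> e) (\<rho> e') \<Longrightarrow> e = e'" using assms(1) by (simp add: encoding_iff)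
  ultimately show "e = e'" using assms(2) by (cases e; cases e') auto
qed

lemma universal_via_insert:
  assumes U: "universal_via U \<rho>" and s: "\<And>e. \<not> comparable s (\<rho> e)" and N: "monotone_machine N"
  shows "universal_via (U \<union> {(\<tau>, \<sigma>). \<exists>\<pi>. \<tau> = s @ \<pi> \<and> (\<pi>, \<sigma>) \<in> N}) (case_nat s \<rho>)"
proof -
  obtain M where M: "encoding \<rho>" "machine_enumeration M" "U = adjunction \<rho> M"
    using U universal_via_iff by blast
  have ex_nat: "(\<exists>e. P e) \<longleftrightarrow> P 0 \<or> (\<exists>e. P (Suc e))" for P by (metis nat.exhaust)
  have "U \<union> {(\<tau>, \<sigma>). \<exists>\<pi>. \<tau> = s @ \<pi> \<and> (\<pi>, \<sigma>) \<in> N} = adjunction (case_nat s \<rho>) (case_nat N M)"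
    unfolding M(3) adjunction_def ex_nat[of "\<lambda>e. \<exists>\<pi>. _ = case_nat s \<rho> e @ \<pi> \<and> (\<pi>, _) \<in> case_nat N M e"]
    by auto
  then show ?thesis
    unfolding universal_via_iff using encoding_case_nat[OF M(1) s] machine_enumeration_case_nat[OF M(2) N] by blast
qed

text \<open>Each \<open>s\<close> in \<open>S\<close> becomes a further codeword, behind which the
  residual of \<open>P\<close> at \<open>s\<close> is placed; so the part of \<open>P\<close> above
  \<open>S\<close> is absorbed one codeword at a time.\<close>

lemma universal_via_extend:
  assumes P: "monotone_machine P" and U: "universal_via U \<rho>"
    and "finite S" "\<And>s t. s \<in> S \<Longrightarrow> t \<in> S \<Longrightarrow> comparable s t \<Longrightarrow> s = t"
    and "\<And>s e. s \<in> S \<Longrightarrow> \<not> comparable s (\<rho> e)"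
  shows "\<exists>\<rho>'. universal_via (U \<union> {(\<tau>, \<sigma>) \<in> P. \<exists>s\<in>S. prefix s \<tau>}) \<rho>' \<and> range \<rho>' = S \<union> range \<rho>"
  using assms(3-5)
proof (induction S)
  case empty
  then show ?case using U by (intro exI[of _ \<rho>]) simp
next
  case (insert s S)
  obtain \<rho>' where \<rho>': "universal_via (U \<union> {(\<tau>, \<sigma>) \<in> P. \<exists>s\<in>S. prefix s \<tau>}) \<rho>'" "range \<rho>' = S \<union> range \<rho>"
    using insert.IH insert.prems by blast
  have "\<not> comparable s (\<rho>' e)" for e
  proof -
    have "\<rho>' e \<in> S \<union> range \<rho>" using \<rho>'(2) by blast
    then consider "\<rho>' e \<in> S" | e' where "\<rho>' e = \<rho> e'" by blast
    then show ?thesis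
    proof cases
      case 1
      then show ?thesis using insert.prems(1)[of s "\<rho>' e"] insert.hyps(2) by auto
    next
      case 2
      then show ?thesis using insert.prems(2)[of s] by simp
    qed
  qed
  from universal_via_insert[OF \<rho>'(1) this monotone_machine_residual[OF P, of s]]
  have "universal_via (U \<union> {(\<tau>, \<sigma>) \<in> P. \<exists>s\<in>S. prefix s \<tau>} \<union>
      {(\<tau>, \<sigma>). \<exists>\<pi>. \<tau> = s @ \<pi> \<and> (\<pi>, \<sigma>) \<in> residual s P}) (case_nat s \<rho>')" .
  moreover have "U \<union> {(\<tau>, \<sigma>) \<in> P. \<exists>s\<in>S. prefix s \<tau>} \<union> {(\<tau>, \<sigma>). \<exists>\<pi>. \<tau> = s @ \<pi> \<and> (\<pi>, \<sigma>) \<in> residual s P}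
      = U \<union> {(\<tau>, \<sigma>) \<in> P. \<exists>t\<in>insert s S. prefix t \<tau>}"
    by (auto simp: residual_def prefix_def)
  moreover have "range (case_nat s \<rho>') = insert s S \<union> range \<rho>"
  proof -
    have "range (case_nat s \<rho>') = insert s (range \<rho>')"
      by (auto simp: image_iff split: nat.splits)
    then show ?thesis by (simp add: \<rho>'(2))
  qed
  ultimately show ?case by auto
qed

text \<open>A string incomparable with \<theta> leaves it at a first position and so extends the
  sibling there. Siblings at different depths disagree at the smaller depth.\<close>

lemma incomparable_siblings:
  fixes \<theta> :: "bool list"
  defines "s \<equiv> (\<lambda>i. take i \<theta> @ [\<not> \<theta> ! i])"
  shows "i < length \<theta> \<Longrightarrow> \<not> comparable (s i) \<theta>"
    and "i < length \<theta> \<Longrightarrow> j < length \<theta> \<Longrightarrow> comparable (s i) (s j) \<Longrightarrow> i = j"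
    and "\<not> comparable \<tau> \<theta> \<Longrightarrow> \<exists>i<length \<theta>. prefix (s i) \<tau>"
proof -
  have less: False if "i < j" "j < length \<theta>" "comparable (s i) (s j)" for i j
    using comparable_nth[OF that(3), of i] that(1,2) by (simp add: s_def nth_append)
  show "\<not> comparable (s i) \<theta>" if "i < length \<theta>"
    using comparable_nth[of "s i" \<theta> i] that by (auto simp: s_def nth_append)
  show "i = j" if "i < length \<theta>" "j < length \<theta>" "comparable (s i) (s j)"
    using less[of i j] less[of j i] that comparable_sym by (metis linorder_neqE_nat)
  assume "\<not> comparable \<tau> \<theta>"
  then have par: "\<tau> \<parallel> \<theta>" unfolding comparable_def parallel_def by simp
  obtain \<alpha> b \<beta> c \<gamma> where *: "b \<noteq> c" "\<tau> = \<alpha> @ b # \<beta>" "\<theta> = \<alpha> @ c # \<gamma>"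
    using parallel_decomp[OF par] by (elim exE conjE) (rule that)
  then have "s (length \<alpha>) = \<alpha> @ [b]" by (simp add: s_def)
  with * show "\<exists>i<length \<theta>. prefix (s i) \<tau>" by (intro exI[of _ "length \<alpha>"]) simp
qed

section \<open>Transfer of a universal machine from one measure to another\<close>

lemma ex_universal_via_transformation_eq:
  assumes mu: "computable_measure \<mu>" "atomless_cantor_measure \<mu>"
    and nu: "computable_measure \<nu>" "atomless_cantor_measure \<nu>"
    and U: "universal_via U \<rho>" and pos: "\<And>e. 0 < measure \<mu> (cylinder (\<rho> e))"
  obtains V \<rho>' where "universal_via V \<rho>'" "\<And>e. 0 < measure \<nu> (cylinder (\<rho>' e))"
    "transformation \<nu> V = transformation \<mu> U"
proof -
  interpret mu: atomless_cantor_measure \<mu> by fact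
  interpret nu: atomless_cantor_measure \<nu> by fact
  note lam = computable_measure_fair_coin
    atomless_cantor_measureI[OF computable_measure_fair_coin continuous_measure_fair_coin]
  interpret lam: atomless_cantor_measure fair_coin_measure by (rule lam)
  note cantor = mu.cantor_measure_axioms nu.cantor_measure_axioms lam.cantor_measure_axioms
  obtain M where M: "encoding \<rho>" "machine_enumeration M" "U = adjunction \<rho> M"
    using U universal_via_iff by blast
  have \<rho>: "computable (\<lambda>e. string_code (\<rho> e))" "\<And>e e'. comparable (\<rho> e) (\<rho> e') \<Longrightarrow> e = e'"
    using M(1) by (simp_all add: encoding_iff computable_strings_def)
  have ce: "uniformly_ce M" using M(2) by (simp add: machine_enumeration_def)

  \<comment> \<open>The search succeeds because the codewords have positive \<mu>-measure.\<close>
  obtain \<theta> where \<theta>: "computable_strings \<theta>" "\<And>k. fits_in \<mu> (\<rho> k) \<nu> (\<theta> k)"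
  proof (rule semidecidable_choice_string)
    show "semidecidable (\<lambda>z. fits_in \<mu> (\<rho> (fst (prod_decode z))) \<nu> (string_decode (snd (prod_decode z))))"
      by (intro semidecidable_fits_in mu nu computable_intros computable_comp[OF \<rho>(1)])
    show "\<exists>\<sigma>. fits_in \<mu> (\<rho> k) \<nu> \<sigma>" for k by (rule ex_fits_in[OF mu(2) nu(2) pos])
  qed blast
  note \<theta>_comp = computable_comp[OF \<theta>(1)[unfolded computable_strings_def]]
  \<comment> \<open>A detour through the uniform measure: \<open>\<theta> k @ \<rho> e\<close> may
    be null for \<nu>, whereas every extension of \<open>\<delta> k\<close> has positive uniform
    measure.\<close>
  obtain \<delta> where \<delta>: "computable_strings \<delta>" "\<And>k. fits_in \<nu> (\<theta> k) fair_coin_measure (\<delta> k)"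
  proof (rule semidecidable_choice_string)
    show "semidecidable (\<lambda>z. fits_in \<nu> (\<theta> (fst (prod_decode z))) fair_coin_measure (string_decode (snd (prod_decode z))))"
      by (intro semidecidable_fits_in lam nu computable_intros \<theta>_comp)
    show "\<exists>\<sigma>. fits_in \<nu> (\<theta> k) fair_coin_measure \<sigma>" for k
      by (rule ex_fits_in[OF nu(2) lam(2) fits_in_pos[OF \<theta>(2)]])
  qed blast
  note \<delta>_comp = computable_comp[OF \<delta>(1)[unfolded computable_strings_def]]
  \<comment> \<open>The codewords \<open>\<delta> k @ \<rho> e\<close>, prefix-free in
    \<open>e\<close>, are carried back to \<nu>, uniformly in the pair of \<open>k\<close> and
    \<open>e\<close>.\<close>
  obtain \<eta> where \<eta>: "computable_strings \<eta>"
    "\<And>z. fits_in fair_coin_measure (\<delta> (fst (prod_decode z)) @ \<rho> (snd (prod_decode z))) \<nu> (\<eta> z)"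
  proof (rule semidecidable_choice_string)
    show "semidecidable (\<lambda>z. fits_in fair_coin_measure
        (\<delta> (fst (prod_decode (fst (prod_decode z)))) @ \<rho> (snd (prod_decode (fst (prod_decode z)))))
        \<nu> (string_decode (snd (prod_decode z))))"
      by (intro semidecidable_fits_in lam nu computable_intros \<delta>_comp computable_comp[OF \<rho>(1)])
    show "\<exists>\<sigma>. fits_in fair_coin_measure (\<delta> (fst (prod_decode z)) @ \<rho> (snd (prod_decode z))) \<nu> \<sigma>" for z
      by (rule ex_fits_in[OF lam(2) nu(2)]) (simp add: fair_coin_measure_cylinder)
  qed blast
  note \<eta>_comp = computable_comp[OF \<eta>(1)[unfolded computable_strings_def]]
  define enc where "enc k e = \<eta> (prod_encode (k, e))" for k e
  have enc_fits: "fits_in fair_coin_measure (\<delta> k @ \<rho> e) \<nu> (enc k e)" for k e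
    using \<eta>(2)[of "prod_encode (k, e)"] by (simp add: enc_def)
  have enc_free: "e = e'" if "comparable (enc k e) (enc k e')" for k e e'
    using comparable_if_fits_in[OF cantor(3,2) enc_fits enc_fits that] \<rho>(2)
    by (simp add: comparable_append_cancel)
  \<comment> \<open>The \<nu>-interval of \<open>enc k e\<close> lies in the uniform interval of
    \<open>\<delta> k\<close>, which lies in the \<nu>-interval of \<open>\<theta> k\<close>; within
    one measure, fitting implies extending.\<close>
  have enc_prefix: "prefix (\<theta> k) (enc k e)" for k e
    by (rule nu.prefix_if_fits_in, rule fits_in_trans[OF \<delta>(2)], rule lam.fits_in_prefix[OF enc_fits]) simp

  define V\<^sub>0 where "V\<^sub>0 k = adjunction (enc k) M" for k
  have V\<^sub>0_consistent: "consistent (V\<^sub>0 k)" for k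
    unfolding V\<^sub>0_def by (intro consistent_adjunction enc_free machine_enumeration_consistent(2)[OF M(2)])
  \<comment> \<open>The machine that \<open>M k\<close> has to be for the part of \<open>U\<close>
    above \<open>\<rho> k\<close> to be the transport of \<open>V\<^sub>0 k\<close> to
    \<mu>.\<close>
  define T where "T k = residual (\<rho> k) (transport_machine \<nu> \<mu> (V\<^sub>0 k))" for k
  \<comment> \<open>Unfolded to one existential formula, from which enumerability can be read
    off.\<close>
  have T_eq: "T = (\<lambda>k. {(\<pi>, \<sigma>). \<exists>e \<tau>. (\<tau>, \<sigma>) \<in> M e \<and> fits_in \<nu> (enc k e @ \<tau>) \<mu> (\<rho> k @ \<pi>)})"
    unfolding T_def residual_def transport_machine_def V\<^sub>0_def adjunction_def
    by (rule ext) blast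
  have "uniformly_ce T"
    unfolding T_eq enc_def
    by (intro uniformly_ceI semidecidable_intros semidecidable_uniformly_ce[OF ce] semidecidable_fits_in
      mu nu computable_intros \<eta>_comp computable_comp[OF \<rho>(1)])
  moreover have "monotone_machine (T k)" for k
    unfolding monotone_machine_iff
  proof
    have "computable (\<lambda>z. prod_encode (k, snd (prod_decode z)))" by (intro computable_intros)
    from semidecidable_comp[OF calculation[unfolded uniformly_ce_iff] this]
    show "uniformly_ce (\<lambda>_. T k)" unfolding uniformly_ce_iff by simp
    show "consistent (T k)"
      unfolding T_def by (intro consistent_residual consistent_transport_machine V\<^sub>0_consistent cantor)
  qed
  ultimately obtain k where k: "M k = T k" using machine_fixed_point[OF M(2,1)] by blast

  define U\<^sub>1 where "U\<^sub>1 = {(\<tau>, \<sigma>) \<in> U. \<not> prefix (\<rho> k) \<tau>}"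
  \<comment> \<open>Inputs of \<open>U\<close> extend codewords, so an input not above
    \<open>\<rho> k\<close> cannot be below it either.\<close>
  have U\<^sub>1_incomparable: "\<not> comparable \<tau> (\<rho> k)" if "(\<tau>, \<sigma>) \<in> U\<^sub>1" for \<tau> \<sigma>
  proof
    assume c: "comparable \<tau> (\<rho> k)"
    obtain e \<pi> where "\<tau> = \<rho> e @ \<pi>" using \<open>(\<tau>, \<sigma>) \<in> U\<^sub>1\<close> unfolding U\<^sub>1_def M(3) adjunction_def by blast
    with c have "e = k" using comparable_append_left \<rho>(2) by blast
    with \<open>\<tau> = \<rho> e @ \<pi>\<close> \<open>(\<tau>, \<sigma>) \<in> U\<^sub>1\<close> show False unfolding U\<^sub>1_def by simp
  qed
  have V\<^sub>0_prefix: "prefix (\<theta> k) \<tau>" if "(\<tau>, \<sigma>) \<in> V\<^sub>0 k" for \<tau> \<sigma>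
    using that enc_prefix unfolding V\<^sub>0_def adjunction_def by (auto intro: prefix_order.trans)
  \<comment> \<open>\<open>M k = T k\<close> concerns inputs above \<open>\<rho> k\<close> only; the
    transported machine has no others, since \<open>\<theta> k\<close> fits in
    \<open>\<rho> k\<close>.\<close>
  have tr_prefix: "prefix (\<rho> k) \<tau>" if "(\<tau>, \<sigma>) \<in> transport_machine \<nu> \<mu> (V\<^sub>0 k)" for \<tau> \<sigma>
  proof -
    obtain \<pi> where "prefix (\<theta> k) \<pi>" "fits_in \<nu> \<pi> \<mu> \<tau>"
      using \<open>(\<tau>, \<sigma>) \<in> transport_machine \<nu> \<mu> (V\<^sub>0 k)\<close> V\<^sub>0_prefix unfolding transport_machine_def by blast
    then show ?thesis
      using mu.prefix_if_fits_in fits_in_trans[OF \<theta>(2)] nu.fits_in_prefix by blast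
  qed
  have U_eq: "U = U\<^sub>1 \<union> transport_machine \<nu> \<mu> (V\<^sub>0 k)"
  proof -
    have "(\<rho> k @ \<pi>, \<sigma>) \<in> U \<longleftrightarrow> (\<rho> k @ \<pi>, \<sigma>) \<in> transport_machine \<nu> \<mu> (V\<^sub>0 k)" for \<pi> \<sigma>
      using mem_adjunction_iff[of \<rho> k \<pi> \<sigma> M] \<rho>(2) unfolding M(3) k T_def residual_def by blast
    then have "(\<tau>, \<sigma>) \<in> U \<longleftrightarrow> (\<tau>, \<sigma>) \<in> transport_machine \<nu> \<mu> (V\<^sub>0 k)" if "prefix (\<rho> k) \<tau>" for \<tau> \<sigma>
      using that by (auto simp: prefix_def)
    then show ?thesis using tr_prefix unfolding U\<^sub>1_def by auto
  qed

  define P where "P = transport_machine \<mu> \<nu> U\<^sub>1"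
  \<comment> \<open>Were an input of \<open>P\<close> comparable with \<open>\<theta> k\<close>, the
    string it came from would be comparable with \<open>\<rho> k\<close>.\<close>
  have P_incomparable: "\<not> comparable \<tau> (\<theta> k)" if \<tau>: "(\<tau>, \<sigma>) \<in> P" for \<tau> \<sigma>
  proof -
    obtain \<pi> where "(\<pi>, \<sigma>) \<in> U\<^sub>1" "fits_in \<mu> \<pi> \<nu> \<tau>" using \<tau> unfolding P_def transport_machine_def by blast
    then show ?thesis using U\<^sub>1_incomparable comparable_if_fits_in[OF cantor(1,2) _ \<theta>(2)] by blast
  qed
  have "monotone_machine P"
    unfolding monotone_machine_iff
  proof
    have U_ce: "uniformly_ce (\<lambda>_. U)" and U_consistent: "consistent U"
      using universal_via_monotone_machine[OF U] by (simp_all add: monotone_machine_iff)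
    show "consistent P"
      unfolding P_def by (intro consistent_transport_machine cantor consistent_subset[OF U_consistent]) (auto simp: U\<^sub>1_def)
    have "P = {(\<pi>, \<sigma>). \<exists>\<tau>. ((\<tau>, \<sigma>) \<in> U \<and> \<not> prefix (\<rho> k) \<tau>) \<and> fits_in \<mu> \<tau> \<nu> \<pi>}"
      unfolding P_def transport_machine_def U\<^sub>1_def by blast
    then show "uniformly_ce (\<lambda>_. P)"
      by (simp only:) (intro uniformly_ceI semidecidable_intros semidecidable_uniformly_ce[OF U_ce, where e = "\<lambda>_. 0"]
        semidecidable_decidable[OF decidable_not] semidecidable_fits_in mu nu computable_intros)
  qed

  define s where "s i = take i (\<theta> k) @ [\<not> \<theta> k ! i]" for i
  note siblings = incomparable_siblings[of _ "\<theta> k", folded s_def]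
  \<comment> \<open>Siblings of \<nu>-measure zero are dropped to keep the result compatible with
    \<nu>; all inputs of \<open>P\<close> have positive measure, so none of them is lost.\<close>
  define S where "S = {t \<in> s ` {..<length (\<theta> k)}. 0 < measure \<nu> (cylinder t)}"
  have "encoding (enc k)"
    unfolding encoding_iff computable_strings_def enc_def
    by (intro conjI \<eta>_comp computable_intros) (use enc_free[unfolded enc_def] in blast)
  then have V\<^sub>0_universal: "universal_via (V\<^sub>0 k) (enc k)" unfolding universal_via_iff V\<^sub>0_def using M(2) by blast
  have "\<exists>\<rho>'. universal_via (V\<^sub>0 k \<union> {(\<tau>, \<sigma>) \<in> P. \<exists>s\<in>S. prefix s \<tau>}) \<rho>' \<and> range \<rho>' = S \<union> range (enc k)"
  proof (rule universal_via_extend[OF \<open>monotone_machine P\<close> V\<^sub>0_universal])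
    show "finite S" by (simp add: S_def)
    show "t = u" if "t \<in> S" "u \<in> S" "comparable t u" for t u
      using that siblings(2) unfolding S_def by auto
    show "\<not> comparable t (enc k e)" if "t \<in> S" for t e
    proof
      assume "comparable t (enc k e)"
      moreover obtain \<tau> where "enc k e = \<theta> k @ \<tau>" using enc_prefix[of k e] by (auto simp: prefix_def)
      ultimately have "comparable t (\<theta> k)" using comparable_append_left comparable_sym by metis
      with \<open>t \<in> S\<close> siblings(1) show False unfolding S_def by auto
    qed
  qed
  then obtain \<rho>' where \<rho>': "universal_via (V\<^sub>0 k \<union> {(\<tau>, \<sigma>) \<in> P. \<exists>s\<in>S. prefix s \<tau>}) \<rho>'"
    "range \<rho>' = S \<union> range (enc k)" by blast
  have "\<exists>t\<in>S. prefix t \<tau>" if \<tau>: "(\<tau>, \<sigma>) \<in> P" for \<tau> \<sigma>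
  proof -
    obtain i where i: "i < length (\<theta> k)" "prefix (s i) \<tau>" using siblings(3) P_incomparable[OF \<tau>] by blast
    have "0 < measure \<nu> (cylinder \<tau>)"
      using \<tau> fits_in_pos unfolding P_def transport_machine_def by blast
    also have "\<dots> \<le> measure \<nu> (cylinder (s i))"
      by (rule nu.finite_measure_mono[OF cylinder_mono[OF i(2)] nu.sets_cylinder])
    finally show ?thesis using i unfolding S_def by blast
  qed
  then have "{(\<tau>, \<sigma>) \<in> P. \<exists>s\<in>S. prefix s \<tau>} = P" by auto
  with \<rho>'(1) have V_universal: "universal_via (V\<^sub>0 k \<union> P) \<rho>'" by simp

  have "transformation \<nu> (V\<^sub>0 k \<union> P) \<sigma> = transformation \<mu> U \<sigma>" for \<sigma>
  proof -
    have "\<not> comparable \<pi> \<tau>" if "(\<pi>, \<sigma>) \<in> V\<^sub>0 k" "(\<tau>, \<upsilon>) \<in> P" for \<pi> \<sigma> \<tau> \<upsilon>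
      using V\<^sub>0_prefix[OF that(1)] P_incomparable[OF that(2)] comparable_append_left comparable_sym
      by (metis prefix_def)
    then have "transformation \<nu> (V\<^sub>0 k \<union> P) \<sigma> = transformation \<nu> (V\<^sub>0 k) \<sigma> + transformation \<nu> P \<sigma>"
      by (rule nu.transformation_Un)
    \<comment> \<open>\<open>P\<close> is \<open>U\<^sub>1\<close> carried from \<mu> to \<nu>,
      while \<open>V\<^sub>0 k\<close> is carried from \<nu> to \<mu>; either way the transformation
      is preserved.\<close>
    also have "\<dots> = transformation \<mu> U\<^sub>1 \<sigma> + transformation \<mu> (transport_machine \<nu> \<mu> (V\<^sub>0 k)) \<sigma>"
      unfolding P_def transformation_transport_machine[OF mu(2) nu(2)]
        transformation_transport_machine[OF nu(2) mu(2)] by simp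
    also have "\<dots> = transformation \<mu> U \<sigma>"
    proof -
      have "\<not> comparable \<pi> \<tau>" if "(\<pi>, \<sigma>) \<in> U\<^sub>1" "(\<tau>, \<upsilon>) \<in> transport_machine \<nu> \<mu> (V\<^sub>0 k)" for \<pi> \<sigma> \<tau> \<upsilon>
        using tr_prefix[OF that(2)] U\<^sub>1_incomparable[OF that(1)] comparable_append_left comparable_sym
        by (metis prefix_def)
      then show ?thesis unfolding U_eq by (rule mu.transformation_Un[symmetric])
    qed
    finally show ?thesis .
  qed
  moreover have "0 < measure \<nu> (cylinder (\<rho>' e))" for e
  proof -
    have "\<rho>' e \<in> S \<union> range (enc k)" using \<rho>'(2) by blast
    then show ?thesis using fits_in_pos[OF enc_fits] unfolding S_def by auto
  qed
  ultimately show thesis using that[OF V_universal] by blast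
qed

section \<open>The two inclusions\<close>

theorem corollary2p8:
  fixes \<mu> :: "(nat \<Rightarrow> bool) measure"
  assumes "computable_measure \<mu>"
    and "continuous_measure \<mu>"
  shows "{transformation \<mu> U |U. universal_machine U \<and> compatible U \<mu>} = apriori_semimeasures"
proof -
  note mu = assms(1) atomless_cantor_measureI[OF assms]
  note lam = computable_measure_fair_coin
    atomless_cantor_measureI[OF computable_measure_fair_coin continuous_measure_fair_coin]
  show ?thesis
  proof (intro equalityI subsetI)
    fix f assume "f \<in> {transformation \<mu> U |U. universal_machine U \<and> compatible U \<mu>}"
    then obtain U \<rho> where U: "f = transformation \<mu> U" "universal_via U \<rho>" "\<And>e. 0 < measure \<mu> (cylinder (\<rho> e))"
      unfolding compatible_def by blast
    obtain V \<rho>' where "universal_via V \<rho>'" "transformation fair_coin_measure V = transformation \<mu> U"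
      using ex_universal_via_transformation_eq[OF mu lam U(2,3)] by blast
    then show "f \<in> apriori_semimeasures"
      unfolding apriori_semimeasures_def universal_machine_def U(1)
      using universal_via_monotone_machine by (intro CollectI exI[of _ V]) auto
  next
    fix f assume "f \<in> apriori_semimeasures"
    then obtain V \<rho> where V: "f = transformation fair_coin_measure V" "universal_via V \<rho>"
      unfolding apriori_semimeasures_def universal_machine_def by blast
    \<comment> \<open>Every universal machine is compatible with the uniform measure, through any of
      its encodings.\<close>
    have "0 < measure fair_coin_measure (cylinder (\<rho> e))" for e
      by (simp add: fair_coin_measure_cylinder)
    then obtain U \<rho>' where "universal_via U \<rho>'" "\<And>e. 0 < measure \<mu> (cylinder (\<rho>' e))"
      "transformation \<mu> U = transformation fair_coin_measure V"
      using ex_universal_via_transformation_eq[OF lam mu V(2)] by blast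
    then show "f \<in> {transformation \<mu> U |U. universal_machine U \<and> compatible U \<mu>}"
      unfolding universal_machine_def compatible_def V(1)
      using universal_via_monotone_machine by (intro CollectI exI[of _ U]) auto
  qed
qed

end
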